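(* Let $X=\{X_t\}_{t\in[0,T]}$ be a positive G-supermartingale and let $0=t_0<t_1<\dots<t_n=T$ be a strictly increasing sequence. Then for all real positive numbers $a$ and $b$ such that $a<b$, $$\hat{\mathbb{E}}\big[D_a^b[X,n]\big]\le\frac{1}{b-a}\,\hat{\mathbb{E}}[X_0\wedge b],$$ where $D_a^b[X,n]$ is the number of downcrossings of the interval $[a,b]$ by $\{X_{t_i}\}_{i=0}^n$.
   Context: Setting. Fix $\sigma_0\in[0,1]$ and let $G(\alpha)=\frac12(\alpha^+-\sigma_0^2\alpha^-)$, where $\alpha^+=\max\{0,\alpha\}$, $\alpha^-=-\min\{0,\alpha\}$. $C_{l,lip}(\mathbb{R}^m)$ is the space of functions $\varphi:\mathbb{R}^m\to\mathbb{R}$ with $|\varphi(x)-\varphi(y)|\le C(1+|x|^n+|y|^n)|x-y|$ for some $C>0$, $n\in\mathbb{N}$ depending on $\varphi$. $\Omega=C_0(\mathbb{R}^+)$ is the space of continuous $\omega:[0,\infty)\to\mathbb{R}$ with $\omega_0=0$ (topology of locally uniform convergence), $B_t(\omega)=\omega_t$. $L_{ip}^0(\mathcal{F}_t)=\{\varphi(B_{t_1},\dots,B_{t_m}): m\ge1,\ t_i\in[0,t],\ \varphi\in C_{l,lip}(\mathbb{R}^m)\}$, $L^0_{ip}(\mathcal{F})=\bigcup_nL^0_{ip}(\mathcal{F}_n)$. A sublinear expectation is a functional $\mathbb{E}$ on a linear space of random variables (stable under composition with functions in $C_{l,lip}$) that is monotone, preserves constants, satisfies $\mathbb{E}[X]-\mathbb{E}[Y]\le\mathbb{E}[X-Y]$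 and is positively homogeneous. $Y$ is independent of $X$ if $\mathbb{E}[\varphi(X,Y)]=\mathbb{E}\big[\mathbb{E}[\varphi(x,Y)]_{x=X}\big]$ for all $\varphi\in C_{l,lip}$. $\xi\sim\mathcal{N}(0,[\sigma_0^2,1])$ means that for every $\varphi\in C_{l,lip}(\mathbb{R})$, $u(t,x)=\mathbb{E}[\varphi(x+\sqrt t\,\xi)]$ is the unique continuous viscosity solution with polynomial growth of $\partial_tu=G(\partial^2_{xx}u)$, $u(0,\cdot)=\varphi$. G-expectation $\hat{\mathbb{E}}$: for $0=t_0\le\dots\le t_m$ and $X=\varphi(B_{t_1}-B_{t_0},\dots,B_{t_m}-B_{t_{m-1}})$, $\hat{\mathbb{E}}[X]=\tilde{\mathbb{E}}[\varphi(\sqrt{t_1-t_0}\,\xi_1,\dots,\sqrt{t_m-t_{m-1}}\,\xi_m)]$, where under a sublinear expectation $\tilde{\mathbb{E}}$, $\xi_i\sim\mathcal{N}(0,[\sigma_0^2,1])$ and $\xi_{i+1}$ is independent of $(\xi_1,\dots,\xi_i)$; and $\hat{\mathbb{E}}[X|\mathcal{H}_{t_j}]=\psi(B_{t_1}-B_{t_0},\dots,B_{t_j}-B_{t_{j-1}})$ with $\psi(x_1,\dots,x_j)=\tilde{\mathbb{E}}[\varphi(x_1,\dots,x_j,\sqrt{t_{j+1}-t_j}\,\xi_{j+1},\dots,\sqrt{t_m-t_{m-1}}\,\xi_m)]$. For $p\ge1$, $L_G^p(\mathcal{F})$, $L_G^p(\mathcal{F}_t)$ are the completions of $L_{ip}^0(\mathcal{F})$,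 $L_{ip}^0(\mathcal{F}_t)$ under $\|X\|_p=\hat{\mathbb{E}}[|X|^p]^{1/p}$; $\hat{\mathbb{E}}[\cdot]$ and $\hat{\mathbb{E}}[\cdot|\mathcal{H}_t]$ extend continuously. There is a weakly compact family $\mathcal{P}$ of probability measures on $(\Omega,\mathcal{B}(\Omega))$ with $\hat{\mathbb{E}}[X]=\max_{P\in\mathcal{P}}E_P[X]$ for $X\in L_G^1(\mathcal{F})$; for other random variables $\hat{\mathbb{E}}[X]:=\sup_{P\in\mathcal{P}}E_P[X]$. Quasi-surely (q.s.) means outside a set $N$ with $c(N):=\sup_{P\in\mathcal{P}}P(N)=0$. A process $X$ is a G-supermartingale if $X_t\in L_G^1(\mathcal{F}_t)$ for all $t$ and $\hat{\mathbb{E}}[X_t|\mathcal{H}_s]\le X_s$ q.s. for all $s\le t$. The number of downcrossings of $[a,b]$ by a finite sequence $x_0,\dots,x_n$ is the largest $k$ for which there are indices $0\le s_1<r_1<s_2<r_2<\dots<s_k<r_k\le n$ with $x_{s_i}\ge b$ and $x_{r_i}\le a$ for all $i$. *)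

theory Defs
  imports "HOL-Probability.Probability"
begin

section \<open>The space of continuous paths starting at the origin\<close>

text \<open>A path on \<open>[0,\<infinity>)\<close> is encoded as a function on all reals that vanishes at negative times.\<close>

typedef C0 = "{\<omega> :: real \<Rightarrow> real. continuous_on {0..} \<omega> \<and> \<omega> 0 = 0 \<and> (\<forall>t<0. \<omega> t = 0)}"
  morphisms path_fun Abs_C0
  by (rule exI[of _ "\<lambda>_. 0"]) auto

definition B :: "real \<Rightarrow> C0 \<Rightarrow> real" where
  "B t \<omega> = path_fun \<omega> t"

text \<open>The topology of locally uniform convergence; consequently \<open>borel\<close> at type \<open>C0 measure\<close> is
  the Borel sigma-algebra of the path space.\<close>

instantiation C0 :: topological_space
begin

definition open_C0 :: "C0 set \<Rightarrow> bool" where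
  "open_C0 U \<longleftrightarrow>
    (\<forall>\<omega>\<in>U. \<exists>T e. e > 0 \<and> {\<omega>'. \<forall>t\<in>{0..T}. \<bar>path_fun \<omega>' t - path_fun \<omega> t\<bar> < e} \<subseteq> U)"

instance
proof
  show "open (UNIV :: C0 set)"
    unfolding open_C0_def by (auto intro: exI[of _ "1::real"])
next
  fix S U :: "C0 set"
  assume S: "open S" and U: "open U"
  show "open (S \<inter> U)"
    unfolding open_C0_def
  proof
    fix \<omega> assume w: "\<omega> \<in> S \<inter> U"
    obtain T1 e1 where 1: "e1 > 0"
      "{\<omega>'. \<forall>t\<in>{0..T1}. \<bar>path_fun \<omega>' t - path_fun \<omega> t\<bar> < e1} \<subseteq> S"
      using S w unfolding open_C0_def by blast
    obtain T2 e2 where 2: "e2 > 0"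
      "{\<omega>'. \<forall>t\<in>{0..T2}. \<bar>path_fun \<omega>' t - path_fun \<omega> t\<bar> < e2} \<subseteq> U"
      using U w unfolding open_C0_def by blast
    have "{\<omega>'. \<forall>t\<in>{0..max T1 T2}. \<bar>path_fun \<omega>' t - path_fun \<omega> t\<bar> < min e1 e2} \<subseteq> S \<inter> U"
    proof
      fix v assume v: "v \<in> {\<omega>'. \<forall>t\<in>{0..max T1 T2}. \<bar>path_fun \<omega>' t - path_fun \<omega> t\<bar> < min e1 e2}"
      have "v \<in> S" using v by (intro subsetD[OF 1(2)]) auto
      moreover have "v \<in> U" using v by (intro subsetD[OF 2(2)]) auto
      ultimately show "v \<in> S \<inter> U" by simp
    qed
    then show "\<exists>T e. e > 0 \<and>
        {\<omega>'. \<forall>t\<in>{0..T}. \<bar>path_fun \<omega>' t - path_fun \<omega> t\<bar> < e} \<subseteq> S \<inter> U"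
      using 1(1) 2(1) by (intro exI[of _ "max T1 T2"] exI[of _ "min e1 e2"]) auto
  qed
next
  fix K :: "C0 set set"
  assume K: "\<forall>S\<in>K. open S"
  show "open (\<Union>K)"
    unfolding open_C0_def
  proof
    fix \<omega> assume "\<omega> \<in> \<Union>K"
    then obtain S where S: "S \<in> K" "\<omega> \<in> S" by blast
    then obtain T e where "e > 0"
      "{\<omega>'. \<forall>t\<in>{0..T}. \<bar>path_fun \<omega>' t - path_fun \<omega> t\<bar> < e} \<subseteq> S"
      using K unfolding open_C0_def by blast
    then show "\<exists>T e. e > 0 \<and>
        {\<omega>'. \<forall>t\<in>{0..T}. \<bar>path_fun \<omega>' t - path_fun \<omega> t\<bar> < e} \<subseteq> \<Union>K"
      using S(1) by blast
  qed
qed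

end


section \<open>Locally Lipschitz functions of polynomial growth and cylinder random variables\<close>

text \<open>Since the dimension varies, a vector of \<open>\<real>\<^sup>m\<close> is a list of length \<open>m\<close>; the values of a function
  in \<open>Cllip m\<close> on lists of other lengths are irrelevant.\<close>

definition enorm :: "real list \<Rightarrow> real" where
  "enorm x = L2_set (\<lambda>i. x ! i) {..<length x}"

definition edist :: "real list \<Rightarrow> real list \<Rightarrow> real" where
  "edist x y = L2_set (\<lambda>i. x ! i - y ! i) {..<length x}"

definition Cllip :: "nat \<Rightarrow> (real list \<Rightarrow> real) set" where
  "Cllip m = {\<phi>. \<exists>C>0. \<exists>n::nat. \<forall>x y. length x = m \<longrightarrow> length y = m \<longrightarrow>
      \<bar>\<phi> x - \<phi> y\<bar> \<le> C * (1 + enorm x ^ n + enorm y ^ n) * edist x y}"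

definition Lip :: "real \<Rightarrow> (C0 \<Rightarrow> real) set" where
  "Lip t = {\<lambda>\<omega>. \<phi> (map (\<lambda>s. B s \<omega>) ts) | \<phi> ts.
      ts \<noteq> [] \<and> set ts \<subseteq> {0..t} \<and> \<phi> \<in> Cllip (length ts)}"

definition Lip_all :: "(C0 \<Rightarrow> real) set" where
  "Lip_all = (\<Union>n::nat. Lip (real n))"


section \<open>Sublinear expectations and the G-normal distribution\<close>

locale sublinear_expectation =
  fixes H :: "('b \<Rightarrow> real) set" and E :: "('b \<Rightarrow> real) \<Rightarrow> real"
  assumes zero_mem: "(\<lambda>_. 0) \<in> H"
    and add_mem: "X \<in> H \<Longrightarrow> Y \<in> H \<Longrightarrow> (\<lambda>\<omega>. X \<omega> + Y \<omega>) \<in> H"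
    and scale_mem: "X \<in> H \<Longrightarrow> (\<lambda>\<omega>. c * X \<omega>) \<in> H"
    and comp_mem: "Xs \<noteq> [] \<Longrightarrow> set Xs \<subseteq> H \<Longrightarrow> \<phi> \<in> Cllip (length Xs) \<Longrightarrow>
      (\<lambda>\<omega>. \<phi> (map (\<lambda>X. X \<omega>) Xs)) \<in> H"
    and mono: "X \<in> H \<Longrightarrow> Y \<in> H \<Longrightarrow> (\<And>\<omega>. X \<omega> \<le> Y \<omega>) \<Longrightarrow> E X \<le> E Y"
    and const: "E (\<lambda>_. c) = c"
    and subadd: "X \<in> H \<Longrightarrow> Y \<in> H \<Longrightarrow> E X - E Y \<le> E (\<lambda>\<omega>. X \<omega> - Y \<omega>)"
    and pos_homogeneous: "X \<in> H \<Longrightarrow> c \<ge> 0 \<Longrightarrow> E (\<lambda>\<omega>. c * X \<omega>) = c * E X"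

definition indep_of :: "(('b \<Rightarrow> real) \<Rightarrow> real) \<Rightarrow> ('b \<Rightarrow> real) list \<Rightarrow> ('b \<Rightarrow> real) list \<Rightarrow> bool" where
  "indep_of E Ys Xs \<longleftrightarrow> (\<forall>\<phi>\<in>Cllip (length Xs + length Ys).
      E (\<lambda>\<omega>. \<phi> (map (\<lambda>X. X \<omega>) Xs @ map (\<lambda>Y. Y \<omega>) Ys)) =
      E (\<lambda>\<omega>. E (\<lambda>\<omega>'. \<phi> (map (\<lambda>X. X \<omega>) Xs @ map (\<lambda>Y. Y \<omega>') Ys))))"

definition G :: "real \<Rightarrow> real \<Rightarrow> real" where
  "G \<sigma>\<^sub>0 \<alpha> = 1/2 * (max 0 \<alpha> - \<sigma>\<^sub>0\<^sup>2 * (- min 0 \<alpha>))"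

text \<open>\<open>\<psi>\<close> is of class \<open>C\<^sup>1\<^sup>,\<^sup>2\<close> on \<open>(0,\<infinity>) \<times> \<real>\<close>, with derivatives
  \<open>\<partial>\<^sub>t\<psi> = \<psi>t\<close>, \<open>\<partial>\<^sub>x\<psi> = \<psi>x\<close>, \<open>\<partial>\<^sub>x\<^sub>x\<psi> = \<psi>xx\<close>.\<close>

definition C12_with_derivs :: "(real \<Rightarrow> real \<Rightarrow> real) \<Rightarrow> (real \<Rightarrow> real \<Rightarrow> real) \<Rightarrow>
    (real \<Rightarrow> real \<Rightarrow> real) \<Rightarrow> (real \<Rightarrow> real \<Rightarrow> real) \<Rightarrow> bool" where
  "C12_with_derivs \<psi> \<psi>t \<psi>x \<psi>xx \<longleftrightarrow>
    (\<forall>t>0. \<forall>x. ((\<lambda>s. \<psi> s x) has_real_derivative \<psi>t t x) (at t) \<and>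
      (\<psi> t has_real_derivative \<psi>x t x) (at x) \<and>
      (\<psi>x t has_real_derivative \<psi>xx t x) (at x)) \<and>
    (\<forall>f\<in>{\<psi>, \<psi>t, \<psi>x, \<psi>xx}. continuous_on ({0<..} \<times> UNIV) (\<lambda>(t, x). f t x))"

definition viscosity_subsolution :: "real \<Rightarrow> (real \<Rightarrow> real \<Rightarrow> real) \<Rightarrow> bool" where
  "viscosity_subsolution \<sigma>\<^sub>0 u \<longleftrightarrow>
    (\<forall>\<psi> \<psi>t \<psi>x \<psi>xx t x. C12_with_derivs \<psi> \<psi>t \<psi>x \<psi>xx \<longrightarrow> t > 0 \<longrightarrow>
      (\<forall>\<^sub>F (s, y) in nhds (t, x). u s y - \<psi> s y \<le> u t x - \<psi> t x) \<longrightarrow>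
      \<psi>t t x \<le> G \<sigma>\<^sub>0 (\<psi>xx t x))"

definition viscosity_supersolution :: "real \<Rightarrow> (real \<Rightarrow> real \<Rightarrow> real) \<Rightarrow> bool" where
  "viscosity_supersolution \<sigma>\<^sub>0 u \<longleftrightarrow>
    (\<forall>\<psi> \<psi>t \<psi>x \<psi>xx t x. C12_with_derivs \<psi> \<psi>t \<psi>x \<psi>xx \<longrightarrow> t > 0 \<longrightarrow>
      (\<forall>\<^sub>F (s, y) in nhds (t, x). u s y - \<psi> s y \<ge> u t x - \<psi> t x) \<longrightarrow>
      \<psi>t t x \<ge> G \<sigma>\<^sub>0 (\<psi>xx t x))"

text \<open>Continuous viscosity solutions of \<open>\<partial>\<^sub>tu = G(\<partial>\<^sub>x\<^sub>xu)\<close> on \<open>[0,\<infinity>) \<times> \<real>\<close> with initial value \<open>g\<close>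
  and polynomial growth in space, locally uniformly in time.\<close>

definition G_heat_solution ::
    "real \<Rightarrow> (real \<Rightarrow> real) \<Rightarrow> (real \<Rightarrow> real \<Rightarrow> real) \<Rightarrow> bool" where
  "G_heat_solution \<sigma>\<^sub>0 g u \<longleftrightarrow>
    continuous_on ({0..} \<times> UNIV) (\<lambda>(t, x). u t x) \<and>
    (\<forall>T\<ge>0. \<exists>C. \<exists>n::nat. \<forall>t\<in>{0..T}. \<forall>x. \<bar>u t x\<bar> \<le> C * (1 + \<bar>x\<bar> ^ n)) \<and>
    viscosity_subsolution \<sigma>\<^sub>0 u \<and> viscosity_supersolution \<sigma>\<^sub>0 u \<and>
    (\<forall>x. u 0 x = g x)"

definition unique_G_heat_solution ::
    "real \<Rightarrow> (real \<Rightarrow> real) \<Rightarrow> (real \<Rightarrow> real \<Rightarrow> real) \<Rightarrow> bool" where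
  "unique_G_heat_solution \<sigma>\<^sub>0 g u \<longleftrightarrow> G_heat_solution \<sigma>\<^sub>0 g u \<and>
    (\<forall>v. G_heat_solution \<sigma>\<^sub>0 g v \<longrightarrow> (\<forall>t\<ge>0. \<forall>x. v t x = u t x))"

definition G_normal :: "real \<Rightarrow> (('b \<Rightarrow> real) \<Rightarrow> real) \<Rightarrow> ('b \<Rightarrow> real) \<Rightarrow> bool" where
  "G_normal \<sigma>\<^sub>0 E \<xi> \<longleftrightarrow> (\<forall>\<phi>\<in>Cllip 1.
      unique_G_heat_solution \<sigma>\<^sub>0 (\<lambda>x. \<phi> [x]) (\<lambda>t x. E (\<lambda>\<omega>. \<phi> [x + sqrt t * \<xi> \<omega>])))"

text \<open>The sequence is indexed from \<open>0\<close>, so \<open>\<xi> i\<close> is the variable usually written \<open>\<xi>\<^sub>i\<^sub>+\<^sub>1\<close>.\<close>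

definition G_normal_sequence :: "real \<Rightarrow> ('b \<Rightarrow> real) set \<Rightarrow> (('b \<Rightarrow> real) \<Rightarrow> real) \<Rightarrow>
    (nat \<Rightarrow> 'b \<Rightarrow> real) \<Rightarrow> bool" where
  "G_normal_sequence \<sigma>\<^sub>0 H E \<xi> \<longleftrightarrow>
    (\<forall>i. \<xi> i \<in> H \<and> G_normal \<sigma>\<^sub>0 E (\<xi> i)) \<and>
    (\<forall>i\<ge>1. indep_of E [\<xi> i] (map \<xi> [0..<i]))"


section \<open>G-expectation and conditional G-expectation of cylinder random variables\<close>

definition time_grid :: "nat \<Rightarrow> (nat \<Rightarrow> real) \<Rightarrow> bool" where
  "time_grid m t \<longleftrightarrow> t 0 = 0 \<and> (\<forall>i<m. t i \<le> t (Suc i))"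

definition increments :: "(nat \<Rightarrow> real) \<Rightarrow> nat \<Rightarrow> C0 \<Rightarrow> real list" where
  "increments t m \<omega> = map (\<lambda>i. B (t (Suc i)) \<omega> - B (t i) \<omega>) [0..<m]"

definition scaled_normals :: "(nat \<Rightarrow> 'b \<Rightarrow> real) \<Rightarrow> (nat \<Rightarrow> real) \<Rightarrow> nat \<Rightarrow> nat \<Rightarrow> 'b \<Rightarrow> real list" where
  "scaled_normals \<xi> t j m \<omega> = map (\<lambda>i. sqrt (t (Suc i) - t i) * \<xi> i \<omega>) [j..<m]"

text \<open>Values of the G-expectation and of the conditional G-expectation on cylinder variables, as
  relations: \<open>cyl_gexp E \<xi> X r\<close> says that \<open>r\<close> is the G-expectation of \<open>X\<close> computed from some
  representation of \<open>X\<close> through Brownian increments, and \<open>cyl_cond_gexp E \<xi> s X Y\<close> says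
  the same for \<open>Y\<close> and the conditional G-expectation given \<open>\<H>\<^sub>s\<close>. (Different representations give
  the same value.)\<close>

definition cyl_gexp :: "(('b \<Rightarrow> real) \<Rightarrow> real) \<Rightarrow> (nat \<Rightarrow> 'b \<Rightarrow> real) \<Rightarrow>
    (C0 \<Rightarrow> real) \<Rightarrow> real \<Rightarrow> bool" where
  "cyl_gexp E \<xi> X r \<longleftrightarrow> (\<exists>m t \<phi>. m \<ge> 1 \<and> time_grid m t \<and> \<phi> \<in> Cllip m \<and>
      X = (\<lambda>\<omega>. \<phi> (increments t m \<omega>)) \<and>
      r = E (\<lambda>\<omega>. \<phi> (scaled_normals \<xi> t 0 m \<omega>)))"

definition cyl_cond_gexp :: "(('b \<Rightarrow> real) \<Rightarrow> real) \<Rightarrow> (nat \<Rightarrow> 'b \<Rightarrow> real) \<Rightarrow> real \<Rightarrow>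
    (C0 \<Rightarrow> real) \<Rightarrow> (C0 \<Rightarrow> real) \<Rightarrow> bool" where
  "cyl_cond_gexp E \<xi> s X Y \<longleftrightarrow> (\<exists>m t \<phi> j. m \<ge> 1 \<and> time_grid m t \<and> \<phi> \<in> Cllip m \<and>
      j \<le> m \<and> t j = s \<and>
      X = (\<lambda>\<omega>. \<phi> (increments t m \<omega>)) \<and>
      Y = (\<lambda>\<omega>. E (\<lambda>\<omega>'. \<phi> (increments t j \<omega> @ scaled_normals \<xi> t j m \<omega>'))))"


section \<open>Upper expectation, capacity and the representing family\<close>

text \<open>The expectation \<open>E\<^sub>P[X] = E\<^sub>P[X\<^sup>+] - E\<^sub>P[X\<^sup>-]\<close> with values in the extended reals; the Bochner
  integral would silently be \<open>0\<close> for non-integrable \<open>X\<close>.\<close>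

definition ext_expectation :: "'a measure \<Rightarrow> ('a \<Rightarrow> real) \<Rightarrow> ereal" where
  "ext_expectation P X =
    enn2ereal (\<integral>\<^sup>+\<omega>. ennreal (X \<omega>) \<partial>P) - enn2ereal (\<integral>\<^sup>+\<omega>. ennreal (- X \<omega>) \<partial>P)"

definition upper_exp :: "C0 measure set \<Rightarrow> (C0 \<Rightarrow> real) \<Rightarrow> ereal" where
  "upper_exp \<P> X = (SUP P\<in>\<P>. ext_expectation P X)"

definition capacity :: "C0 measure set \<Rightarrow> C0 set \<Rightarrow> ennreal" where
  "capacity \<P> N = (SUP P\<in>\<P>. emeasure P N)"

definition quasi_surely :: "C0 measure set \<Rightarrow> (C0 \<Rightarrow> bool) \<Rightarrow> bool" where
  "quasi_surely \<P> Q \<longleftrightarrow> (\<exists>N\<in>sets borel. capacity \<P> N = 0 \<and> (\<forall>\<omega>. \<omega> \<notin> N \<longrightarrow> Q \<omega>))"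

definition prob_measures :: "C0 measure set" where
  "prob_measures = {P. prob_space P \<and> sets P = sets borel}"

definition weak_topology :: "C0 measure topology" where
  "weak_topology = topology_generated_by
    {{P \<in> prob_measures. (\<integral>\<omega>. f \<omega> \<partial>P) \<in> U} | f U.
      continuous_on UNIV f \<and> bounded (range f) \<and> open (U :: real set)}"

text \<open>Completion of a space \<open>L\<close> of cylinder variables for the norm \<open>E[|X|]\<close>, realised by
  random variables (representatives of classes modulo quasi-sure equality). For the representing
  families defined below this norm agrees on cylinder variables with the G-expectation of \<open>|X|\<close>.\<close>

definition L1_completion :: "C0 measure set \<Rightarrow> (C0 \<Rightarrow> real) set \<Rightarrow> (C0 \<Rightarrow> real) set" where
  "L1_completion \<P> L = {X \<in> borel_measurable borel. \<exists>Xn. (\<forall>n::nat. Xn n \<in> L) \<and>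
      (\<lambda>n. upper_exp \<P> (\<lambda>\<omega>. \<bar>Xn n \<omega> - X \<omega>\<bar>)) \<longlonglongrightarrow> 0}"

abbreviation LG1 :: "C0 measure set \<Rightarrow> real \<Rightarrow> (C0 \<Rightarrow> real) set" where
  "LG1 \<P> t \<equiv> L1_completion \<P> (Lip t)"

abbreviation LG1_all :: "C0 measure set \<Rightarrow> (C0 \<Rightarrow> real) set" where
  "LG1_all \<P> \<equiv> L1_completion \<P> Lip_all"

text \<open>A weakly compact family of probability measures with \<open>E[X] = max\<^sub>P E\<^sub>P[X]\<close>. The
  supremum equals the G-expectation on cylinder variables, hence so does its unique continuous
  extension to the completion, where moreover the supremum is attained.\<close>

definition represents_gexp :: "(('b \<Rightarrow> real) \<Rightarrow> real) \<Rightarrow> (nat \<Rightarrow> 'b \<Rightarrow> real) \<Rightarrow>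
    C0 measure set \<Rightarrow> bool" where
  "represents_gexp E \<xi> \<P> \<longleftrightarrow>
    \<P> \<subseteq> prob_measures \<and> compactin weak_topology \<P> \<and>
    (\<forall>X r. cyl_gexp E \<xi> X r \<longrightarrow> upper_exp \<P> X = ereal r) \<and>
    (\<forall>X\<in>LG1_all \<P>. \<exists>P\<in>\<P>. ext_expectation P X = upper_exp \<P> X)"


section \<open>Conditional G-expectation, G-supermartingales, downcrossings\<close>

text \<open>\<open>Y\<close> is a version of the conditional G-expectation of \<open>X\<close> given \<open>\<H>\<^sub>s\<close>, defined by continuous
  extension from cylinder variables; \<open>Y\<close> is determined up to quasi-sure equality.\<close>

definition has_cond_gexp :: "(('b \<Rightarrow> real) \<Rightarrow> real) \<Rightarrow> (nat \<Rightarrow> 'b \<Rightarrow> real) \<Rightarrow> C0 measure set \<Rightarrow>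
    real \<Rightarrow> (C0 \<Rightarrow> real) \<Rightarrow> (C0 \<Rightarrow> real) \<Rightarrow> bool" where
  "has_cond_gexp E \<xi> \<P> s X Y \<longleftrightarrow> X \<in> LG1_all \<P> \<and> Y \<in> LG1 \<P> s \<and>
    (\<exists>Xn Yn. (\<forall>n::nat. cyl_cond_gexp E \<xi> s (Xn n) (Yn n)) \<and>
      (\<lambda>n. upper_exp \<P> (\<lambda>\<omega>. \<bar>Xn n \<omega> - X \<omega>\<bar>)) \<longlonglongrightarrow> 0 \<and>
      (\<lambda>n. upper_exp \<P> (\<lambda>\<omega>. \<bar>Yn n \<omega> - Y \<omega>\<bar>)) \<longlonglongrightarrow> 0)"

definition G_supermartingale :: "(('b \<Rightarrow> real) \<Rightarrow> real) \<Rightarrow> (nat \<Rightarrow> 'b \<Rightarrow> real) \<Rightarrow>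
    C0 measure set \<Rightarrow> real \<Rightarrow> (real \<Rightarrow> C0 \<Rightarrow> real) \<Rightarrow> bool" where
  "G_supermartingale E \<xi> \<P> T X \<longleftrightarrow>
    (\<forall>t\<in>{0..T}. X t \<in> LG1 \<P> t) \<and>
    (\<forall>t\<in>{0..T}. \<forall>s\<in>{0..t}. \<exists>Y. has_cond_gexp E \<xi> \<P> s (X t) Y \<and>
      quasi_surely \<P> (\<lambda>\<omega>. Y \<omega> \<le> X s \<omega>))"

definition downcrossings :: "real \<Rightarrow> real \<Rightarrow> (nat \<Rightarrow> real) \<Rightarrow> nat \<Rightarrow> nat" where
  "downcrossings a b x n = Max {k. \<exists>s r :: nat \<Rightarrow> nat.
      (\<forall>i\<in>{1..k}. s i < r i \<and> r i \<le> n \<and> x (s i) \<ge> b \<and> x (r i) \<le> a) \<and>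
      (\<forall>i\<in>{1..<k}. r i < s (Suc i))}"

end

theory Submission
  imports Defs
begin

text \<open>
  The G-expectation is the supremum of the expectations under the measures \<open>P \<in> \<P>\<close>, so it suffices to
  prove the inequality under each \<open>P\<close> separately (\<open>ext_expectation_downcrossings\<close>) and take suprema.

  Under a fixed \<open>P\<close> the process is an ordinary nonnegative supermartingale. The reason is that a
  cylinder variable \<open>X\<close> with conditional G-expectation \<open>Y\<close> at time \<open>s\<close> satisfies \<open>E[(X - Y) Z] = 0\<close>
  for every nonnegative cylinder variable \<open>Z\<close> of the past of \<open>s\<close> (\<open>cond_gexp_tested\<close>): once the past is
  frozen, \<open>Y\<close> is the sublinear expectation of \<open>X\<close> and \<open>Z\<close> is a nonnegative constant. Hence
  \<open>E\<^sub>P[(X - Y) Z] \<le> 0\<close>, which survives \<open>L\<^sup>1\<close> limits in \<open>X\<close> and \<open>Y\<close> (\<open>cond_gexp_dominates\<close>) and the passage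
  from \<open>Z\<close> to indicators of events that cylinder variables of the past approximate in \<open>L\<^sup>1(P)\<close>
  (\<open>approximable_tested\<close>). These events form an algebra containing all \<open>{X\<^sub>u \<ge> c}\<close> and \<open>{X\<^sub>u \<le> c}\<close>
  with \<open>u \<le> s\<close>, hence every decision of a strategy that observes \<open>X\<close> at finitely many times.

  What remains is Doob's argument. Starting with \<open>min (X\<^sub>0) b\<close>, hold one unit of \<open>X\<close> except between an
  instant where \<open>X \<ge> b\<close> and the next instant where \<open>X \<le> a\<close>. Each downcrossing leaves a profit
  of \<open>b - a\<close>, so the final wealth is at least \<open>(b - a)\<close> times their number (\<open>completed_wealth\<close>), while
  its expectation is at most that of the initial capital.
\<close>

section \<open>Locally Lipschitz functions of polynomial growth\<close>

lemma nth_diff_le_edist: "i < length x \<Longrightarrow> \<bar>x ! i - y ! i\<bar> \<le> edist x y"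
  unfolding edist_def
  using member_le_L2_set[of "{..<length x}" i "\<lambda>i. \<bar>x ! i - y ! i\<bar>"] by (simp add: L2_set_def)

lemma edist_le_sum: "edist x y \<le> (\<Sum>i<length x. \<bar>x ! i - y ! i\<bar>)"
  unfolding edist_def by (rule L2_set_le_sum_abs)

lemma edist_nonneg [simp]: "0 \<le> edist x y" and enorm_nonneg [simp]: "0 \<le> enorm x"
  by (simp_all add: edist_def enorm_def)

lemma enorm_zero [simp]: "enorm (replicate m 0) = 0"
  by (simp add: enorm_def L2_set_def)

lemma edist_zero: "edist x (replicate (length x) 0) = enorm x"
  by (simp add: enorm_def edist_def L2_set_def)

lemma enorm_le_sum: "enorm x \<le> (\<Sum>i<length x. \<bar>x ! i\<bar>)"
  unfolding enorm_def by (rule L2_set_le_sum_abs)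

lemma edist_snoc: "length x = length y \<Longrightarrow> edist (x @ [u]) (y @ [u]) = edist x y"
  by (simp add: edist_def L2_set_def nth_append)

lemma enorm_snoc_le: "enorm (x @ [u]) \<le> enorm x + \<bar>u\<bar>"
proof -
  have "enorm (x @ [u]) = sqrt ((enorm x)\<^sup>2 + u\<^sup>2)"
    by (simp add: enorm_def L2_set_def nth_append sum_nonneg)
  also have "\<dots> \<le> sqrt ((enorm x)\<^sup>2) + sqrt (u\<^sup>2)" by (rule sqrt_add_le_add_sqrt) simp_all
  finally show ?thesis by simp
qed

text \<open>The growth condition is easier to handle with the single factor
  \<open>(1 + \<bar>x\<bar> + \<bar>y\<bar>) ^ n\<close>: being a power of a number at least one, it is monotone in \<open>n\<close>, and
  products and powers of such factors have the same shape.\<close>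

lemma CllipI:
  assumes "0 \<le> C" and "\<And>x y. length x = m \<Longrightarrow> length y = m \<Longrightarrow>
    \<bar>\<phi> x - \<phi> y\<bar> \<le> C * (1 + enorm x + enorm y) ^ n * edist x y"
  shows "\<phi> \<in> Cllip m"
proof -
  have *: "(1 + a + b) ^ n \<le> 3 ^ n * (1 + a ^ n + b ^ n)" if "0 \<le> a" "0 \<le> b" for a b :: real
  proof -
    define M where "M = max 1 (max a b)"
    have "(1 + a + b) ^ n \<le> (3 * M) ^ n" using that by (intro power_mono) (auto simp: M_def)
    also have "\<dots> = 3 ^ n * M ^ n" by (simp add: power_mult_distrib)
    also have "M ^ n \<le> 1 + a ^ n + b ^ n"
      using that by (cases "M = 1"; cases "M = a") (auto simp: M_def max_def split: if_splits)
    finally show ?thesis by simp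
  qed
  have "\<bar>\<phi> x - \<phi> y\<bar> \<le> (C * 3 ^ n + 1) * (1 + enorm x ^ n + enorm y ^ n) * edist x y"
    if "length x = m" "length y = m" for x y
  proof -
    have "\<bar>\<phi> x - \<phi> y\<bar> \<le> C * (3 ^ n * (1 + enorm x ^ n + enorm y ^ n)) * edist x y"
      using assms(2)[OF that] * assms(1)
      by (meson enorm_nonneg edist_nonneg mult_left_mono mult_right_mono order_trans)
    also have "\<dots> \<le> (C * 3 ^ n + 1) * (1 + enorm x ^ n + enorm y ^ n) * edist x y"
      by (intro mult_right_mono) (auto simp: algebra_simps add_nonneg_nonneg)
    finally show ?thesis .
  qed
  moreover have "C * 3 ^ n + 1 > 0" using assms(1) by (simp add: add_nonneg_pos)
  ultimately show ?thesis unfolding Cllip_def by blast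
qed

lemma CllipE:
  assumes "\<phi> \<in> Cllip m"
  obtains C n where "0 \<le> C" and "\<And>x y. length x = m \<Longrightarrow> length y = m \<Longrightarrow>
    \<bar>\<phi> x - \<phi> y\<bar> \<le> C * (1 + enorm x + enorm y) ^ n * edist x y"
proof -
  obtain C n where C: "C > 0" "\<And>x y. length x = m \<Longrightarrow> length y = m \<Longrightarrow>
      \<bar>\<phi> x - \<phi> y\<bar> \<le> C * (1 + enorm x ^ n + enorm y ^ n) * edist x y"
    using assms unfolding Cllip_def by blast
  have *: "1 + a ^ n + b ^ n \<le> 3 * (1 + a + b) ^ n" if "0 \<le> a" "0 \<le> b" for a b :: real
  proof -
    have "1 \<le> (1 + a + b) ^ n" "a ^ n \<le> (1 + a + b) ^ n" "b ^ n \<le> (1 + a + b) ^ n"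
      using that by (auto intro!: power_mono one_le_power)
    then show ?thesis by linarith
  qed
  have "\<bar>\<phi> x - \<phi> y\<bar> \<le> (C * 3) * (1 + enorm x + enorm y) ^ n * edist x y"
    if "length x = m" "length y = m" for x y
  proof -
    have "\<bar>\<phi> x - \<phi> y\<bar> \<le> C * (1 + enorm x ^ n + enorm y ^ n) * edist x y" by (rule C(2)[OF that])
    also have "\<dots> \<le> C * (3 * (1 + enorm x + enorm y) ^ n) * edist x y"
      using C(1) * by (intro mult_right_mono mult_left_mono) auto
    finally show ?thesis by simp
  qed
  then show ?thesis using that[of "C * 3" n] C(1) by simp
qed

lemma Cllip_cong:
  assumes "\<phi> \<in> Cllip m" and "\<And>x. length x = m \<Longrightarrow> \<phi> x = \<phi>' x"
  shows "\<phi>' \<in> Cllip m"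
  using assms unfolding Cllip_def by simp

text \<open>One constant and one exponent serve a whole list of functions. The growth bound on \<open>\<bar>g x\<bar>\<close> comes
  from comparing \<open>x\<close> with the origin.\<close>

lemma Cllip_uniform_bounds:
  assumes "set gs \<subseteq> Cllip m"
  shows "\<exists>C\<ge>0. \<exists>n. \<forall>g\<in>set gs. \<forall>x y. length x = m \<longrightarrow> length y = m \<longrightarrow>
    \<bar>g x\<bar> \<le> C * (1 + enorm x + enorm y) ^ n \<and>
    \<bar>g x - g y\<bar> \<le> C * (1 + enorm x + enorm y) ^ n * edist x y"
  using assms
proof (induction gs)
  case (Cons g gs)
  obtain C n where C: "0 \<le> C" "\<And>x y. length x = m \<Longrightarrow> length y = m \<Longrightarrow>
      \<bar>g x - g y\<bar> \<le> C * (1 + enorm x + enorm y) ^ n * edist x y"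
    using CllipE[of g m] Cons.prems by auto
  obtain C' n' where C': "0 \<le> C'" "\<And>h x y. h \<in> set gs \<Longrightarrow> length x = m \<Longrightarrow> length y = m \<Longrightarrow>
      \<bar>h x\<bar> \<le> C' * (1 + enorm x + enorm y) ^ n' \<and>
      \<bar>h x - h y\<bar> \<le> C' * (1 + enorm x + enorm y) ^ n' * edist x y"
    using Cons.IH Cons.prems by (metis (no_types, lifting) insert_subset list.simps(15))
  define z where "z = replicate m (0 :: real)"
  define K where "K = C + \<bar>g z\<bar> + C'"
  \<comment> \<open>The extra factor absorbs \<open>\<bar>x\<bar>\<close> in the growth bound of \<open>g\<close>.\<close>
  define N where "N = Suc n + n'"
  have K: "0 \<le> K" "C \<le> K" "C' \<le> K" "C + \<bar>g z\<bar> \<le> K" using C(1) C'(1) by (auto simp: K_def)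
  have "\<bar>h x\<bar> \<le> K * (1 + enorm x + enorm y) ^ N \<and>
    \<bar>h x - h y\<bar> \<le> K * (1 + enorm x + enorm y) ^ N * edist x y"
    if h: "h \<in> set (g # gs)" and x: "length x = m" and y: "length y = m" for h x y
  proof -
    let ?w = "1 + enorm x + enorm y"
    have w: "1 \<le> ?w" by simp
    have mono: "c * ?w ^ k \<le> K * ?w ^ N" if "c \<le> K" "k \<le> N" for c k
    proof -
      have "c * ?w ^ k \<le> K * ?w ^ k" using that w by (intro mult_right_mono) auto
      also have "\<dots> \<le> K * ?w ^ N" using that w K(1) by (intro mult_left_mono power_increasing) auto
      finally show ?thesis .
    qed
    show ?thesis
    proof (cases "h \<in> set gs")
      case True
      have "C' * ?w ^ n' \<le> K * ?w ^ N" by (rule mono) (use K in \<open>auto simp: N_def\<close>)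
      then show ?thesis using C'(2)[OF True x y] by (meson edist_nonneg mult_right_mono order_trans)
    next
      case False
      then have h: "h = g" using h by simp
      have "C * ?w ^ n \<le> K * ?w ^ N" by (rule mono) (use K in \<open>auto simp: N_def\<close>)
      then have 1: "\<bar>g x - g y\<bar> \<le> K * ?w ^ N * edist x y"
        using C(2)[OF x y] by (meson edist_nonneg mult_right_mono order_trans)
      have "\<bar>g x\<bar> \<le> \<bar>g z\<bar> + \<bar>g x - g z\<bar>" by simp
      also have "\<bar>g x - g z\<bar> \<le> C * (1 + enorm x) ^ n * enorm x"
        using C(2)[of x z] x edist_zero[of x] by (simp add: z_def)
      also have "C * (1 + enorm x) ^ n * enorm x \<le> C * ?w ^ n * ?w"
        using C(1) by (intro mult_mono mult_left_mono power_mono) auto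
      also have "\<bar>g z\<bar> + C * ?w ^ n * ?w \<le> \<bar>g z\<bar> * ?w ^ Suc n + C * ?w ^ Suc n"
        using mult_left_mono[OF one_le_power[OF w, of "Suc n"], of "\<bar>g z\<bar>"] by simp
      also have "\<dots> = (C + \<bar>g z\<bar>) * ?w ^ Suc n" by (simp add: algebra_simps)
      also have "\<dots> \<le> K * ?w ^ N" by (rule mono) (use K in \<open>auto simp: N_def\<close>)
      finally show ?thesis using 1 h by simp
    qed
  qed
  then show ?case using K(1) by blast
qed auto

text \<open>Every closure property of \<open>Cllip\<close> needed later, including those under projection, concatenation
  and linear changes of coordinates, is an instance of closure under composition. The bounds compose
  because \<open>\<bar>g x\<bar>\<close> is itself dominated by a power of \<open>1 + \<bar>x\<bar> + \<bar>y\<bar>\<close>.\<close>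

theorem Cllip_comp:
  assumes \<phi>: "\<phi> \<in> Cllip (length gs)" and gs: "set gs \<subseteq> Cllip m"
  shows "(\<lambda>x. \<phi> (map (\<lambda>g. g x) gs)) \<in> Cllip m"
proof -
  obtain D N where D: "0 \<le> D" "\<And>x y. length x = length gs \<Longrightarrow> length y = length gs \<Longrightarrow>
      \<bar>\<phi> x - \<phi> y\<bar> \<le> D * (1 + enorm x + enorm y) ^ N * edist x y"
    using CllipE[OF \<phi>] by metis
  obtain C n where C: "0 \<le> C" "\<And>g x y. g \<in> set gs \<Longrightarrow> length x = m \<Longrightarrow> length y = m \<Longrightarrow>
      \<bar>g x\<bar> \<le> C * (1 + enorm x + enorm y) ^ n \<and>
      \<bar>g x - g y\<bar> \<le> C * (1 + enorm x + enorm y) ^ n * edist x y"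
    using Cllip_uniform_bounds[OF gs] by blast
  define k where "k = real (length gs)"
  show ?thesis
  proof (rule CllipI)
    show "0 \<le> D * (1 + 2 * k * C) ^ N * (k * C)" using D(1) C(1) by (simp add: k_def)
    fix x y :: "real list" assume x: "length x = m" and y: "length y = m"
    let ?w = "1 + enorm x + enorm y"
    let ?X = "map (\<lambda>g. g x) gs" and ?Y = "map (\<lambda>g. g y) gs"
    have w: "1 \<le> ?w" by simp
    have d: "edist ?X ?Y \<le> k * C * ?w ^ n * edist x y"
    proof -
      have "edist ?X ?Y \<le> (\<Sum>i<length gs. \<bar>?X ! i - ?Y ! i\<bar>)" using edist_le_sum[of ?X ?Y] by simp
      also have "\<dots> \<le> (\<Sum>i<length gs. C * ?w ^ n * edist x y)"
        by (intro sum_mono) (use C(2) x y in auto)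
      finally show ?thesis by (simp add: k_def)
    qed
    have eX: "enorm ?X \<le> k * C * ?w ^ n" and eY: "enorm ?Y \<le> k * C * ?w ^ n"
    proof -
      have "enorm ?X \<le> (\<Sum>i<length gs. \<bar>?X ! i\<bar>)" using enorm_le_sum[of ?X] by simp
      also have "\<dots> \<le> (\<Sum>i<length gs. C * ?w ^ n)"
        by (intro sum_mono) (use C(2) x y in auto)
      finally show "enorm ?X \<le> k * C * ?w ^ n" by (simp add: k_def)
      have "enorm ?Y \<le> (\<Sum>i<length gs. \<bar>?Y ! i\<bar>)" using enorm_le_sum[of ?Y] by simp
      also have "\<dots> \<le> (\<Sum>i<length gs. C * ?w ^ n)"
        using C(2)[OF _ y x] by (intro sum_mono) (auto simp: algebra_simps)
      finally show "enorm ?Y \<le> k * C * ?w ^ n" by (simp add: k_def)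
    qed
    have "\<bar>\<phi> ?X - \<phi> ?Y\<bar> \<le> D * (1 + enorm ?X + enorm ?Y) ^ N * edist ?X ?Y"
      by (rule D(2)) simp_all
    also have "\<dots> \<le> D * ((1 + 2 * k * C) * ?w ^ n) ^ N * (k * C * ?w ^ n * edist x y)"
    proof (intro mult_mono mult_left_mono power_mono d)
      have 1: "1 \<le> ?w ^ n" using w by (rule one_le_power)
      show "1 + enorm ?X + enorm ?Y \<le> (1 + 2 * k * C) * ?w ^ n"
        using add_mono[OF 1 add_mono[OF eX eY]] by (simp add: algebra_simps)
    qed (use D(1) C(1) in \<open>auto simp: k_def\<close>)
    also have "\<dots> = D * (1 + 2 * k * C) ^ N * (k * C) * ?w ^ (n * N + n) * edist x y"
      by (simp add: power_mult_distrib power_add power_mult)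
    finally show "\<bar>\<phi> ?X - \<phi> ?Y\<bar> \<le> \<dots>" .
  qed
qed

lemma Cllip_const [simp]: "(\<lambda>x. c) \<in> Cllip m"
  by (rule CllipI[of 0 _ _ 0]) auto

lemma Cllip_nth: "i < m \<Longrightarrow> (\<lambda>x. x ! i) \<in> Cllip m"
  by (rule CllipI[of 1 _ _ 0]) (use nth_diff_le_edist in auto)

lemma Cllip_add:
  assumes "f \<in> Cllip m" "g \<in> Cllip m"
  shows "(\<lambda>x. f x + g x) \<in> Cllip m"
proof -
  have "(\<lambda>l. l ! 0 + l ! 1 :: real) \<in> Cllip 2"
  proof (rule CllipI[of 2 _ _ 0])
    fix x y :: "real list" assume "length x = 2" "length y = 2"
    then show "\<bar>(x ! 0 + x ! 1) - (y ! 0 + y ! 1)\<bar> \<le> 2 * (1 + enorm x + enorm y) ^ 0 * edist x y"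
      using nth_diff_le_edist[of 0 x y] nth_diff_le_edist[of 1 x y] by auto
  qed simp
  from Cllip_comp[of _ "[f, g]", simplified, OF this[unfolded numeral_2_eq_2]] show ?thesis
    using assms by simp
qed

lemma Cllip_mult:
  assumes "f \<in> Cllip m" "g \<in> Cllip m"
  shows "(\<lambda>x. f x * g x) \<in> Cllip m"
proof -
  have "(\<lambda>l. l ! 0 * l ! 1 :: real) \<in> Cllip 2"
  proof (rule CllipI[of 1 _ _ 1])
    fix x y :: "real list" assume l: "length x = 2" "length y = 2"
    have x: "\<bar>x ! 0\<bar> \<le> enorm x" and y: "\<bar>y ! 1\<bar> \<le> enorm y"
      using l nth_diff_le_edist[of 0 x "replicate 2 0"] nth_diff_le_edist[of 1 y "replicate 2 0"]
        edist_zero[of x] edist_zero[of y] by auto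
    have "\<bar>x ! 0 * x ! 1 - y ! 0 * y ! 1\<bar> = \<bar>x ! 0 * (x ! 1 - y ! 1) + y ! 1 * (x ! 0 - y ! 0)\<bar>"
      by (simp add: algebra_simps)
    also have "\<dots> \<le> \<bar>x ! 0\<bar> * \<bar>x ! 1 - y ! 1\<bar> + \<bar>y ! 1\<bar> * \<bar>x ! 0 - y ! 0\<bar>"
      using abs_triangle_ineq by (metis abs_mult)
    also have "\<dots> \<le> enorm x * edist x y + enorm y * edist x y"
      using x y l by (intro add_mono mult_mono nth_diff_le_edist) auto
    also have "\<dots> \<le> 1 * (1 + enorm x + enorm y) ^ 1 * edist x y"
      by (simp add: algebra_simps)
    finally show "\<bar>x ! 0 * x ! 1 - y ! 0 * y ! 1\<bar> \<le> 1 * (1 + enorm x + enorm y) ^ 1 * edist x y" .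
  qed simp
  from Cllip_comp[of _ "[f, g]", simplified, OF this[unfolded numeral_2_eq_2]] show ?thesis
    using assms by simp
qed

lemma Cllip_abs:
  assumes "f \<in> Cllip m"
  shows "(\<lambda>x. \<bar>f x\<bar>) \<in> Cllip m"
proof -
  obtain C n where C: "0 \<le> C" "\<And>x y. length x = m \<Longrightarrow> length y = m \<Longrightarrow>
      \<bar>f x - f y\<bar> \<le> C * (1 + enorm x + enorm y) ^ n * edist x y"
    using CllipE[OF assms] by metis
  show ?thesis
    by (rule CllipI[OF C(1)]) (use C(2) abs_triangle_ineq3 order_trans in blast)
qed

lemma Cllip_diff: "f \<in> Cllip m \<Longrightarrow> g \<in> Cllip m \<Longrightarrow> (\<lambda>x. f x - g x) \<in> Cllip m"
  using Cllip_add[of f m "\<lambda>x. (-1) * g x"] Cllip_mult[of "\<lambda>x. -1" m g] by simp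

lemma Cllip_max:
  assumes "f \<in> Cllip m" "g \<in> Cllip m"
  shows "(\<lambda>x. max (f x) (g x)) \<in> Cllip m"
proof -
  have "(\<lambda>x. (1/2) * ((f x + g x) + \<bar>f x - g x\<bar>)) \<in> Cllip m"
    using assms by (intro Cllip_mult Cllip_add Cllip_abs Cllip_diff) auto
  moreover have "(\<lambda>x. (1/2) * ((f x + g x) + \<bar>f x - g x\<bar>)) = (\<lambda>x. max (f x) (g x))"
    by (auto simp: max_def)
  ultimately show ?thesis by simp
qed

lemma Cllip_sum: "(\<And>i. i \<in> I \<Longrightarrow> f i \<in> Cllip m) \<Longrightarrow> (\<lambda>x. \<Sum>i\<in>I. f i x) \<in> Cllip m"
  by (induction I rule: infinite_finite_induct) (auto intro: Cllip_add)

lemma Cllip_power: "f \<in> Cllip m \<Longrightarrow> (\<lambda>x. f x ^ k) \<in> Cllip m"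
  by (induction k) (auto intro: Cllip_mult)

lemma Cllip_take: 
  assumes "g \<in> Cllip j" "j \<le> m"
  shows "(\<lambda>x. g (take j x)) \<in> Cllip m"
proof -
  have "(\<lambda>x. g (map (\<lambda>h. h x) (map (\<lambda>i x. x ! i) [0..<j]))) \<in> Cllip m"
    by (rule Cllip_comp) (use assms in \<open>auto intro!: Cllip_nth\<close>)
  then show ?thesis
    by (rule Cllip_cong) (use assms in \<open>auto intro!: arg_cong[where f = g] nth_equalityI\<close>)
qed

lemma Cllip_continuous_comp:
  fixes gs :: "('a::topological_space \<Rightarrow> real) list"
  assumes \<phi>: "\<phi> \<in> Cllip (length gs)" and gs: "\<And>g. g \<in> set gs \<Longrightarrow> continuous_on UNIV g"
  shows "continuous_on UNIV (\<lambda>w. \<phi> (map (\<lambda>g. g w) gs))"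
proof -
  obtain D N where D: "0 \<le> D" "\<And>x y. length x = length gs \<Longrightarrow> length y = length gs \<Longrightarrow>
      \<bar>\<phi> x - \<phi> y\<bar> \<le> D * (1 + enorm x + enorm y) ^ N * edist x y"
    using CllipE[OF \<phi>] by metis
  define V where "V = (\<lambda>w. map (\<lambda>g. g w) gs)"
  have "((\<lambda>w. \<phi> (V w)) \<longlongrightarrow> \<phi> (V v)) (at v)" for v
  proof -
    have lim: "((\<lambda>w. V w ! i) \<longlongrightarrow> V v ! i) (at v)" if "i < length gs" for i
      using gs[of "gs ! i"] that by (auto simp: V_def continuous_on_def)
    have "((\<lambda>w. enorm (V w)) \<longlongrightarrow> enorm (V v)) (at v)"
      unfolding enorm_def L2_set_def using lim by (auto intro!: tendsto_intros simp: V_def)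
    moreover have "((\<lambda>w. edist (V w) (V v)) \<longlongrightarrow> edist (V v) (V v)) (at v)"
    proof -
      have len: "length (V w) = length gs" for w by (simp add: V_def)
      show ?thesis unfolding edist_def L2_set_def len using lim by (intro tendsto_intros) auto
    qed
    ultimately have "((\<lambda>w. D * (1 + enorm (V w) + enorm (V v)) ^ N * edist (V w) (V v))
        \<longlongrightarrow> D * (1 + enorm (V v) + enorm (V v)) ^ N * edist (V v) (V v)) (at v)"
      by (intro tendsto_intros)
    moreover have "edist (V v) (V v) = 0" by (simp add: edist_def L2_set_def)
    ultimately have "((\<lambda>w. D * (1 + enorm (V w) + enorm (V v)) ^ N * edist (V w) (V v)) \<longlongrightarrow> 0) (at v)"
      by simp
    then have "((\<lambda>w. \<phi> (V w) - \<phi> (V v)) \<longlongrightarrow> 0) (at v)"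
      by (rule Lim_null_comparison[rotated]) (use D(2) in \<open>auto simp: V_def\<close>)
    then show ?thesis by (simp add: LIM_zero_iff)
  qed
  then show ?thesis unfolding continuous_on_def V_def by simp
qed

section \<open>Iterated independent expectations\<close>

text \<open>The expectation of \<open>f\<close> at \<open>k\<close> independent copies of one variable with distribution functional \<open>e\<close>,
  the last coordinate being integrated first.\<close>

primrec nested :: "((real \<Rightarrow> real) \<Rightarrow> real) \<Rightarrow> nat \<Rightarrow> (real list \<Rightarrow> real) \<Rightarrow> real" where
  "nested e 0 f = f []"
| "nested e (Suc k) f = nested e k (\<lambda>x. e (\<lambda>u. f (x @ [u])))"

lemma nested_cong: "(\<And>x. length x = k \<Longrightarrow> f x = g x) \<Longrightarrow> nested e k f = nested e k g"
proof (induction k arbitrary: f g)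
  case (Suc k)
  show ?case unfolding nested.simps by (rule Suc.IH) (simp add: Suc.prems)
qed simp

lemma nested_append:
  "nested e (j + k) f = nested e j (\<lambda>x. nested e k (\<lambda>y. f (x @ y)))"
  by (induction k arbitrary: f) simp_all

context sublinear_expectation
begin

lemma H_Cllip1: "Z \<in> H \<Longrightarrow> (\<lambda>l. f (l ! 0)) \<in> Cllip 1 \<Longrightarrow> (\<lambda>\<omega>. f (Z \<omega>)) \<in> H"
  using comp_mem[of "[Z]" "\<lambda>l. f (l ! 0)"] by simp

lemma E_diff_le:
  assumes "X \<in> H" "Y \<in> H" "W \<in> H" and "\<And>\<omega>. \<bar>X \<omega> - Y \<omega>\<bar> \<le> W \<omega>"
  shows "\<bar>E X - E Y\<bar> \<le> E W"
proof -
  have D: "(\<lambda>\<omega>. X \<omega> - Y \<omega>) \<in> H" "(\<lambda>\<omega>. Y \<omega> - X \<omega>) \<in> H"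
    using add_mem[OF assms(1) scale_mem[OF assms(2), of "-1"]]
      add_mem[OF assms(2) scale_mem[OF assms(1), of "-1"]] by simp_all
  have "E X - E Y \<le> E W"
    using subadd[OF assms(1,2)] mono[OF D(1) assms(3)] assms(4) by (meson abs_le_D1 order_trans)
  moreover have "E Y - E X \<le> E W"
    using subadd[OF assms(2,1)] mono[OF D(2) assms(3)] assms(4)
    by (smt (verit))
  ultimately show ?thesis by simp
qed

lemma const_mem: "(\<lambda>\<omega>. c) \<in> H"
  using comp_mem[of "[\<lambda>_. 0]" "\<lambda>_. c"] zero_mem by simp

lemma E_affine:
  assumes "Z \<in> H" "0 \<le> d"
  shows "E (\<lambda>\<omega>. c + d * Z \<omega>) = c + d * E Z"
proof -
  have dZ: "(\<lambda>\<omega>. d * Z \<omega>) \<in> H" by (rule scale_mem[OF assms(1)])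
  have cZ: "(\<lambda>\<omega>. c + d * Z \<omega>) \<in> H" by (rule add_mem[OF const_mem dZ])
  have "E (\<lambda>\<omega>. c + d * Z \<omega>) - E (\<lambda>\<omega>. d * Z \<omega>) \<le> E (\<lambda>\<omega>. c)"
    using subadd[OF cZ dZ] by simp
  moreover have "E (\<lambda>\<omega>. d * Z \<omega>) - E (\<lambda>\<omega>. c + d * Z \<omega>) \<le> E (\<lambda>\<omega>. - c)"
    using subadd[OF dZ cZ] by simp
  ultimately show ?thesis using pos_homogeneous[OF assms] const by simp
qed

text \<open>Integrating out the last coordinate \<open>u\<close> preserves \<open>Cllip\<close>: since
  \<open>1 + \<bar>(x,u)\<bar> + \<bar>(y,u)\<bar> \<le> (1 + \<bar>x\<bar> + \<bar>y\<bar>)(1 + 2\<bar>u\<bar>)\<close>, the weight factorises and only a moment of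
  \<open>Z\<close> is added to the constant. That moment is finite because \<open>E\<close> is real valued on \<open>H\<close>.\<close>

lemma Cllip_partial_E:
  assumes \<phi>: "\<phi> \<in> Cllip (Suc m)" and Z: "Z \<in> H"
  shows "(\<lambda>x. E (\<lambda>\<omega>. \<phi> (x @ [Z \<omega>]))) \<in> Cllip m"
proof -
  obtain C n where C: "0 \<le> C" "\<And>x y. length x = Suc m \<Longrightarrow> length y = Suc m \<Longrightarrow>
      \<bar>\<phi> x - \<phi> y\<bar> \<le> C * (1 + enorm x + enorm y) ^ n * edist x y"
    using CllipE[OF \<phi>] by metis
  have memH: "(\<lambda>\<omega>. \<phi> (x @ [Z \<omega>])) \<in> H" if "length x = m" for x
  proof (rule H_Cllip1[OF Z])
    have "(\<lambda>l. \<phi> (map (\<lambda>g. g l) (map (\<lambda>c l. c) x @ [\<lambda>l. l ! 0]))) \<in> Cllip 1"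
      by (rule Cllip_comp) (use \<phi> that in \<open>auto intro: Cllip_nth\<close>)
    then show "(\<lambda>l. \<phi> (x @ [l ! 0])) \<in> Cllip 1"
      by (simp add: comp_def)
  qed
  define W where "W = (\<lambda>\<omega>. (1 + 2 * \<bar>Z \<omega>\<bar>) ^ n)"
  have W: "W \<in> H" unfolding W_def
    by (rule H_Cllip1[OF Z])
      (intro Cllip_power Cllip_add Cllip_mult Cllip_abs Cllip_nth Cllip_const, simp)
  have EW: "0 \<le> E W"
    using mono[OF const_mem[of 0] W] const[of 0] by (simp add: W_def)
  show ?thesis
  proof (rule CllipI)
    show "0 \<le> C * E W" using C(1) EW by simp
    fix x y :: "real list" assume l: "length x = m" "length y = m"
    let ?w = "1 + enorm x + enorm y"
    have "\<bar>\<phi> (x @ [Z \<omega>]) - \<phi> (y @ [Z \<omega>])\<bar> \<le> 0 + (C * ?w ^ n * edist x y) * W \<omega>" for \<omega>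
    proof -
      let ?u = "Z \<omega>"
      have "\<bar>\<phi> (x @ [?u]) - \<phi> (y @ [?u])\<bar> \<le>
          C * (1 + enorm (x @ [?u]) + enorm (y @ [?u])) ^ n * edist (x @ [?u]) (y @ [?u])"
        by (rule C(2)) (use l in auto)
      also have "\<dots> \<le> C * (?w * (1 + 2 * \<bar>?u\<bar>)) ^ n * edist x y"
      proof -
        have "1 + enorm (x @ [?u]) + enorm (y @ [?u]) \<le> ?w * (1 + 2 * \<bar>?u\<bar>)"
        proof -
          have "?w * (1 + 2 * \<bar>?u\<bar>) =
              ?w + 2 * \<bar>?u\<bar> + 2 * (enorm x * \<bar>?u\<bar>) + 2 * (enorm y * \<bar>?u\<bar>)"
            by (simp add: algebra_simps)
          moreover have "0 \<le> enorm x * \<bar>?u\<bar>" "0 \<le> enorm y * \<bar>?u\<bar>" by simp_all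
          ultimately show ?thesis
            using enorm_snoc_le[of x ?u] enorm_snoc_le[of y ?u] by linarith
        qed
        then show ?thesis using C(1) l
          by (simp add: edist_snoc) (intro mult_right_mono mult_left_mono power_mono, auto)
      qed
      finally show ?thesis by (simp add: W_def power_mult_distrib mult_ac)
    qed
    then have "\<bar>E (\<lambda>\<omega>. \<phi> (x @ [Z \<omega>])) - E (\<lambda>\<omega>. \<phi> (y @ [Z \<omega>]))\<bar>
        \<le> E (\<lambda>\<omega>. 0 + (C * ?w ^ n * edist x y) * W \<omega>)"
      using l by (intro E_diff_le memH add_mem const_mem scale_mem W)
    also have "\<dots> = 0 + (C * ?w ^ n * edist x y) * E W"
      using C(1) by (intro E_affine W) auto
    finally show "\<bar>E (\<lambda>\<omega>. \<phi> (x @ [Z \<omega>])) - E (\<lambda>\<omega>. \<phi> (y @ [Z \<omega>]))\<bar>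
        \<le> C * E W * ?w ^ n * edist x y" by (simp add: mult_ac)
  qed
qed

end

locale G_normal_sequence_space = sublinear_expectation H E
  for H :: "('b \<Rightarrow> real) set" and E :: "('b \<Rightarrow> real) \<Rightarrow> real" +
  fixes \<sigma>\<^sub>0 :: real and \<xi> :: "nat \<Rightarrow> 'b \<Rightarrow> real"
  assumes normal: "G_normal_sequence \<sigma>\<^sub>0 H E \<xi>"
begin

definition law :: "(real \<Rightarrow> real) \<Rightarrow> real" where
  "law h = E (\<lambda>\<omega>. h (\<xi> 0 \<omega>))"

lemma \<xi>_mem: "\<xi> i \<in> H"
  using normal by (simp add: G_normal_sequence_def)

text \<open>Every \<open>\<xi> i\<close> yields a solution of the same Cauchy problem, whose solution is unique; at time one
  and at the origin this solution is the expectation.\<close>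

lemma identically_distributed:
  assumes "(\<lambda>l. h (l ! 0)) \<in> Cllip 1"
  shows "E (\<lambda>\<omega>. h (\<xi> i \<omega>)) = law h"
proof -
  have "unique_G_heat_solution \<sigma>\<^sub>0 (\<lambda>x. h ([x] ! 0))
      (\<lambda>t x. E (\<lambda>\<omega>. h ([x + sqrt t * \<xi> i \<omega>] ! 0)))" for i
  proof -
    have "\<forall>\<phi>\<in>Cllip 1. unique_G_heat_solution \<sigma>\<^sub>0 (\<lambda>x. \<phi> [x])
        (\<lambda>t x. E (\<lambda>\<omega>. \<phi> [x + sqrt t * \<xi> i \<omega>]))"
      using normal unfolding G_normal_sequence_def G_normal_def by simp
    from bspec[OF this assms] show ?thesis .
  qed
  from this[of i] this[of 0] have
    "E (\<lambda>\<omega>. h ([0 + sqrt 1 * \<xi> i \<omega>] ! 0)) = E (\<lambda>\<omega>. h ([0 + sqrt 1 * \<xi> 0 \<omega>] ! 0))"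
    unfolding unique_G_heat_solution_def by (metis zero_le_one)
  then show ?thesis by (simp add: law_def)
qed

lemma Cllip_partial_law: "f \<in> Cllip (Suc k) \<Longrightarrow> (\<lambda>x. law (\<lambda>u. f (x @ [u]))) \<in> Cllip k"
  unfolding law_def using Cllip_partial_E \<xi>_mem by blast

lemma Cllip_nested:
  "f \<in> Cllip (j + k) \<Longrightarrow> (\<lambda>x. nested law k (\<lambda>y. f (x @ y))) \<in> Cllip j"
proof (induction k arbitrary: f)
  case (Suc k)
  have "(\<lambda>z. law (\<lambda>u. f (z @ [u]))) \<in> Cllip (j + k)"
    using Suc.prems by (intro Cllip_partial_law) simp
  from Suc.IH[OF this] show ?case by simp
qed simp

text \<open>A block of \<open>k\<close> consecutive variables has the iterated expectation as its distribution,
  whatever its starting index \<open>j\<close>. Independence is only assumed of the whole initial segment, so the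
  test function is made to ignore the first \<open>j\<close> coordinates.\<close>

lemma E_block:
  "f \<in> Cllip k \<Longrightarrow> E (\<lambda>\<omega>. f (map (\<lambda>i. \<xi> i \<omega>) [j..<j + k])) = nested law k f"
proof (induction k arbitrary: f)
  case 0
  show ?case by (simp add: const)
next
  case (Suc k)
  define g where "g = (\<lambda>x. law (\<lambda>u. f (x @ [u])))"
  have g: "g \<in> Cllip k" unfolding g_def by (rule Cllip_partial_law[OF Suc.prems])
  have snoc: "(\<lambda>l. f (x @ [l ! 0])) \<in> Cllip 1" if "length x = k" for x
  proof -
    have "(\<lambda>l. f (map (\<lambda>g. g l) (map (\<lambda>c l. c) x @ [\<lambda>l. l ! 0]))) \<in> Cllip 1"
      by (rule Cllip_comp) (use Suc.prems that in \<open>auto intro: Cllip_nth\<close>)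
    then show ?thesis by (simp add: comp_def)
  qed
  have "E (\<lambda>\<omega>. f (map (\<lambda>i. \<xi> i \<omega>) [j..<j + k] @ [\<xi> (j + k) \<omega>])) =
      E (\<lambda>\<omega>. E (\<lambda>\<omega>'. f (map (\<lambda>i. \<xi> i \<omega>) [j..<j + k] @ [\<xi> (j + k) \<omega>'])))"
  proof (cases "j + k = 0")
    case True
    then show ?thesis by (simp add: const)
  next
    case False
    have "(\<lambda>x. f (map (\<lambda>g. g x) (map (\<lambda>i x. x ! (j + i)) [0..<Suc k]))) \<in> Cllip (j + k + 1)"
      by (rule Cllip_comp) (use Suc.prems in \<open>auto intro!: Cllip_nth\<close>)
    then have "(\<lambda>x. f (drop j x)) \<in> Cllip (j + k + 1)"
      by (rule Cllip_cong) (auto intro!: arg_cong[where f = f] nth_equalityI simp del: upt_Suc)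
    moreover have "indep_of E [\<xi> (j + k)] (map \<xi> [0..<j + k])"
    proof -
      have "1 \<le> j + k" using False by linarith
      then show ?thesis using normal unfolding G_normal_sequence_def by blast
    qed
    ultimately have
      "E (\<lambda>\<omega>. f (drop j (map (\<lambda>X. X \<omega>) (map \<xi> [0..<j + k]) @ [\<xi> (j + k) \<omega>]))) =
       E (\<lambda>\<omega>. E (\<lambda>\<omega>'. f (drop j (map (\<lambda>X. X \<omega>) (map \<xi> [0..<j + k]) @ [\<xi> (j + k) \<omega>']))))"
      unfolding indep_of_def by (auto dest: bspec[where x = "\<lambda>x. f (drop j x)"])
    then show ?thesis by (simp add: comp_def drop_map)
  qed
  also have "\<dots> = E (\<lambda>\<omega>. g (map (\<lambda>i. \<xi> i \<omega>) [j..<j + k]))"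
    unfolding g_def
    by (intro arg_cong[where f = E] ext identically_distributed snoc) simp
  also have "\<dots> = nested law (Suc k) f" using Suc.IH[OF g] by (simp add: g_def)
  finally show ?case by simp
qed

lemma law_zero: "law (\<lambda>u. 0) = 0"
  by (simp add: law_def const)

lemma nested_zero: "nested law k (\<lambda>x. 0) = 0"
  by (induction k) (simp_all add: law_zero)

lemma nested_affine:
  assumes f: "f \<in> Cllip k" and d: "0 \<le> d"
  shows "nested law k (\<lambda>x. c + d * f x) = c + d * nested law k f"
proof -
  have mem: "(\<lambda>\<omega>. f (map (\<lambda>i. \<xi> i \<omega>) [0..<0 + k])) \<in> H"
  proof (cases "k = 0")
    case False
    then show ?thesis using comp_mem[of "map \<xi> [0..<k]" f] f \<xi>_mem by (auto simp: comp_def)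
  qed (simp add: const_mem)
  have "(\<lambda>x. c + d * f x) \<in> Cllip k" using f by (intro Cllip_add Cllip_mult Cllip_const)
  from E_block[OF this, of 0] E_affine[OF mem d, of c] E_block[OF f, of 0] show ?thesis by simp
qed

text \<open>If \<open>\<psi>\<close> is obtained from \<open>\<phi>\<close> by integrating the last \<open>k\<close> coordinates, then \<open>\<phi> - \<psi>\<close> has
  expectation zero even after multiplication by any nonnegative function \<open>\<zeta>\<close> of the first
  coordinates: with those frozen, \<open>\<psi>\<close> is a constant and \<open>\<zeta>\<close> a nonnegative factor, and a sublinear
  expectation commutes with both.\<close>

lemma nested_centred:
  assumes \<phi>: "\<And>x. length x = j \<Longrightarrow> (\<lambda>y. \<phi> (x @ y)) \<in> Cllip k"
    and \<psi>: "\<And>x. length x = j \<Longrightarrow> \<psi> x = nested law k (\<lambda>y. \<phi> (x @ y))"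
    and \<zeta>: "\<And>x. 0 \<le> \<zeta> x"
  shows "nested law (j + k) (\<lambda>z. (\<phi> z - \<psi> (take j z)) * \<zeta> (take j z)) = 0"
proof -
  have "nested law k (\<lambda>y. (\<phi> (x @ y) - \<psi> x) * \<zeta> x) = 0" if x: "length x = j" for x
  proof -
    have "nested law k (\<lambda>y. (\<phi> (x @ y) - \<psi> x) * \<zeta> x) =
        nested law k (\<lambda>y. - (\<psi> x * \<zeta> x) + \<zeta> x * \<phi> (x @ y))"
      by (simp add: algebra_simps)
    also have "\<dots> = - (\<psi> x * \<zeta> x) + \<zeta> x * nested law k (\<lambda>y. \<phi> (x @ y))"
      by (rule nested_affine[OF \<phi>[OF x] \<zeta>])
    finally show ?thesis by (simp add: \<psi>[OF x])
  qed
  then have "nested law j (\<lambda>x. nested law k (\<lambda>y. (\<phi> (x @ y) - \<psi> x) * \<zeta> x)) = nested law j (\<lambda>x. 0)"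
    by (intro nested_cong)
  also have "nested law j (\<lambda>x. nested law k (\<lambda>y. (\<phi> (x @ y) - \<psi> x) * \<zeta> x)) =
      nested law (j + k) (\<lambda>z. (\<phi> z - \<psi> (take j z)) * \<zeta> (take j z))"
    unfolding nested_append by (rule nested_cong) simp
  finally show ?thesis by (simp add: nested_zero)
qed

end

section \<open>Cylinder variables and time grids\<close>

lemma Lip_cases:
  assumes "X \<in> Lip s"
  obtains \<phi> ts where "ts \<noteq> []" "set ts \<subseteq> {0..s}" "\<phi> \<in> Cllip (length ts)"
    "X = (\<lambda>\<omega>. \<phi> (map (\<lambda>u. B u \<omega>) ts))"
  using assms unfolding Lip_def by blast

lemma LipI:
  "ts \<noteq> [] \<Longrightarrow> set ts \<subseteq> {0..s} \<Longrightarrow> \<phi> \<in> Cllip (length ts) \<Longrightarrow>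
    (\<lambda>\<omega>. \<phi> (map (\<lambda>u. B u \<omega>) ts)) \<in> Lip s"
  unfolding Lip_def by blast

text \<open>Finitely many cylinder variables are functions of the path at common times, so operations of
  \<open>Cllip\<close> apply to them jointly.\<close>

lemma Lip_common_times:
  assumes "0 \<le> s" and "set Xs \<subseteq> Lip s"
  shows "\<exists>ts \<phi>s. ts \<noteq> [] \<and> set ts \<subseteq> {0..s} \<and> set \<phi>s \<subseteq> Cllip (length ts) \<and>
    Xs = map (\<lambda>\<phi> \<omega>. \<phi> (map (\<lambda>u. B u \<omega>) ts)) \<phi>s"
  using assms(2)
proof (induction Xs)
  case Nil
  show ?case using assms(1) by (intro exI[of _ "[0]"] exI[of _ "[]"]) simp
next
  case (Cons X Xs)
  obtain ts \<phi>s where 1: "ts \<noteq> []" "set ts \<subseteq> {0..s}" "set \<phi>s \<subseteq> Cllip (length ts)"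
    "Xs = map (\<lambda>\<phi> \<omega>. \<phi> (map (\<lambda>u. B u \<omega>) ts)) \<phi>s"
    using Cons by auto
  obtain ts' \<phi> where 2: "ts' \<noteq> []" "set ts' \<subseteq> {0..s}" "\<phi> \<in> Cllip (length ts')"
    "X = (\<lambda>\<omega>. \<phi> (map (\<lambda>u. B u \<omega>) ts'))"
    using Lip_cases[of X s] Cons.prems by (metis list.set_intros(1) subsetD)
  define \<phi>' where "\<phi>' = (\<lambda>x. \<phi> (take (length ts') x))"
  define \<phi>s' where "\<phi>s' = map (\<lambda>\<phi> x. \<phi> (drop (length ts') x)) \<phi>s"
  have drop: "(\<lambda>x. f (drop (length ts') x)) \<in> Cllip (length (ts' @ ts))"
    if "f \<in> Cllip (length ts)" for f
  proof -
    have "(\<lambda>x. f (map (\<lambda>g. g x) (map (\<lambda>i x. x ! (length ts' + i)) [0..<length ts])))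
        \<in> Cllip (length (ts' @ ts))"
      by (rule Cllip_comp) (use that in \<open>auto intro!: Cllip_nth\<close>)
    then show ?thesis
      by (rule Cllip_cong) (auto intro!: arg_cong[where f = f] nth_equalityI)
  qed
  have "set (\<phi>' # \<phi>s') \<subseteq> Cllip (length (ts' @ ts))"
    using 1(3) 2(3) drop by (auto simp: \<phi>'_def \<phi>s'_def intro: Cllip_take)
  moreover have "X # Xs = map (\<lambda>\<phi> \<omega>. \<phi> (map (\<lambda>u. B u \<omega>) (ts' @ ts))) (\<phi>' # \<phi>s')"
    by (simp add: 1(4) 2(4) \<phi>'_def \<phi>s'_def)
  ultimately show ?case using 1 2
    by (intro exI[of _ "ts' @ ts"] exI[of _ "\<phi>' # \<phi>s'"]) auto
qed

lemma Lip_comp: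
  assumes "0 \<le> s" and "set Xs \<subseteq> Lip s" and \<phi>: "\<phi> \<in> Cllip (length Xs)"
  shows "(\<lambda>\<omega>. \<phi> (map (\<lambda>X. X \<omega>) Xs)) \<in> Lip s"
proof -
  obtain ts \<phi>s where ts: "ts \<noteq> []" "set ts \<subseteq> {0..s}" "set \<phi>s \<subseteq> Cllip (length ts)"
    and Xs: "Xs = map (\<lambda>\<phi> \<omega>. \<phi> (map (\<lambda>u. B u \<omega>) ts)) \<phi>s"
    using Lip_common_times[OF assms(1,2)] by blast
  have "(\<lambda>x. \<phi> (map (\<lambda>g. g x) \<phi>s)) \<in> Cllip (length ts)"
    by (rule Cllip_comp) (use ts(3) \<phi> Xs in auto)
  from LipI[OF ts(1,2) this] show ?thesis by (simp add: Xs comp_def)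
qed

lemma Lip_comp1:
  "0 \<le> s \<Longrightarrow> X \<in> Lip s \<Longrightarrow> (\<lambda>l. h (l ! 0)) \<in> Cllip 1 \<Longrightarrow> (\<lambda>\<omega>. h (X \<omega>)) \<in> Lip s"
  using Lip_comp[of s "[X]" "\<lambda>l. h (l ! 0)"] by simp

lemma Lip_comp2:
  "0 \<le> s \<Longrightarrow> X \<in> Lip s \<Longrightarrow> Y \<in> Lip s \<Longrightarrow> (\<lambda>l. h (l ! 0) (l ! 1)) \<in> Cllip 2 \<Longrightarrow>
    (\<lambda>\<omega>. h (X \<omega>) (Y \<omega>)) \<in> Lip s"
  using Lip_comp[of s "[X, Y]" "\<lambda>l. h (l ! 0) (l ! 1)"] by (simp add: numeral_2_eq_2)

lemma B_Lip: "0 \<le> u \<Longrightarrow> u \<le> s \<Longrightarrow> B u \<in> Lip s"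
  using LipI[of "[u]" s "\<lambda>x. x ! 0"] by (simp add: Cllip_nth)

lemma Lip_mono: "s \<le> s' \<Longrightarrow> Lip s \<subseteq> Lip s'"
  unfolding Lip_def by fastforce

lemma B_0 [simp]: "B 0 \<omega> = 0"
  using path_fun[of \<omega>] by (simp add: B_def)

lemma time_grid_mono: "time_grid m t \<Longrightarrow> i \<le> k \<Longrightarrow> k \<le> m \<Longrightarrow> t i \<le> t k"
proof (induction k)
  case (Suc k)
  then show ?case
    by (cases "i = Suc k") (auto simp: time_grid_def le_Suc_eq intro: order_trans[of _ "t k"])
qed simp

lemma time_grid_nonneg: "time_grid m t \<Longrightarrow> k \<le> m \<Longrightarrow> 0 \<le> t k"
  using time_grid_mono[of m t 0 k] by (simp add: time_grid_def)

lemma increments_Lip: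
  assumes t: "time_grid m t" and \<phi>: "\<phi> \<in> Cllip m"
  shows "(\<lambda>\<omega>. \<phi> (increments t m \<omega>)) \<in> Lip (t m)"
proof -
  have s: "0 \<le> t m" by (rule time_grid_nonneg[OF t]) simp
  have "(\<lambda>l. l ! 0 - l ! 1 :: real) \<in> Cllip 2" by (intro Cllip_diff Cllip_nth) auto
  then have diff: "(\<lambda>\<omega>. B (t (Suc i)) \<omega> - B (t i) \<omega>) \<in> Lip (t m)" if "i < m" for i
    using that by (intro Lip_comp2[OF s, where h = "\<lambda>x y. x - y"] B_Lip
      time_grid_nonneg[OF t] time_grid_mono[OF t]) simp_all
  have "(\<lambda>\<omega>. \<phi> (map (\<lambda>X. X \<omega>) (map (\<lambda>i \<omega>. B (t (Suc i)) \<omega> - B (t i) \<omega>) [0..<m]))) \<in> Lip (t m)"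
    by (rule Lip_comp[OF s]) (use \<phi> diff in auto)
  then show ?thesis by (simp add: increments_def comp_def)
qed

text \<open>The times \<open>0\<close> and \<open>s\<close> enter the sorted list as separate entries, so that the grid has at
  least one interval even for \<open>s = 0\<close>.\<close>

lemma time_grid_through:
  assumes "set ts \<subseteq> {0..s}" and "0 \<le> s"
  obtains m t where "1 \<le> m" "time_grid m t" "t m = s" "\<And>u. u \<in> set ts \<Longrightarrow> \<exists>i\<le>m. t i = u"
proof -
  define L where "L = sort (0 # s # ts)"
  define m where "m = Suc (length ts)"
  have len: "length L = Suc m" by (simp add: L_def m_def)
  have srt: "sorted L" unfolding L_def by (rule sorted_sort)
  have setL: "set L = insert 0 (insert s (set ts))" by (simp only: L_def set_sort list.set)
  have bounds: "0 \<le> L ! i" "L ! i \<le> s" if "i \<le> m" for i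
    using nth_mem[of i L] that len setL assms by auto
  obtain i where "i \<le> m" "L ! i = 0" using setL len by (metis in_set_conv_nth insertI1 less_Suc_eq_le)
  then have "L ! 0 = 0" using sorted_nth_mono[OF srt, of 0 i] bounds(1)[of 0] len by simp
  obtain i where "i \<le> m" "L ! i = s"
    using setL len by (metis in_set_conv_nth insertI1 insertI2 less_Suc_eq_le)
  then have "L ! m = s" using sorted_nth_mono[OF srt, of i m] bounds(2)[of m] len by simp
  show thesis
  proof (rule that[of m "\<lambda>i. L ! i"])
    show "1 \<le> m" by (simp add: m_def)
    show "time_grid m ((!) L)"
      using \<open>L ! 0 = 0\<close> len sorted_nth_mono[OF srt] by (auto simp: time_grid_def)
    show "L ! m = s" by fact
    show "\<exists>i\<le>m. L ! i = u" if "u \<in> set ts" for u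
      using that setL len by (metis in_set_conv_nth insertI2 less_Suc_eq_le)
  qed
qed

lemma B_eq_sum_increments:
  assumes "t 0 = 0" "i \<le> m"
  shows "B (t i) \<omega> = (\<Sum>l<i. increments t m \<omega> ! l)"
proof -
  have "(\<Sum>l<i. increments t m \<omega> ! l) = (\<Sum>l<i. B (t (Suc l)) \<omega> - B (t l) \<omega>)"
    using assms(2) by (intro sum.cong) (auto simp: increments_def)
  also have "\<dots> = B (t i) \<omega>" using sum_lessThan_telescope[of "\<lambda>l. B (t l) \<omega>" i] by (simp add: assms(1))
  finally show ?thesis by simp
qed

lemma B_via_increments:
  assumes "time_grid m t" "i \<le> m" "t i = u"
  shows "\<exists>g\<in>Cllip m. \<forall>\<omega>. B u \<omega> = g (increments t m \<omega>)"
proof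
  show "(\<lambda>x. \<Sum>l<i. x ! l) \<in> Cllip m"
    by (rule Cllip_sum) (use assms(2) in \<open>auto intro: Cllip_nth\<close>)
  show "\<forall>\<omega>. B u \<omega> = (\<Sum>l<i. increments t m \<omega> ! l)"
    using assms B_eq_sum_increments[of t i m] by (auto simp: time_grid_def)
qed

lemma vector_via_increments:
  assumes t: "time_grid m t" and ts: "\<And>u. u \<in> set ts \<Longrightarrow> \<exists>i\<le>m. t i = u"
  shows "\<exists>gs. length gs = length ts \<and> set gs \<subseteq> Cllip m \<and>
    (\<forall>\<omega>. map (\<lambda>u. B u \<omega>) ts = map (\<lambda>g. g (increments t m \<omega>)) gs)"
  using ts
proof (induction ts)
  case (Cons u ts)
  then obtain gs where "length gs = length ts" "set gs \<subseteq> Cllip m"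
    "\<forall>\<omega>. map (\<lambda>u. B u \<omega>) ts = map (\<lambda>g. g (increments t m \<omega>)) gs" by auto
  moreover obtain g where "g \<in> Cllip m" "\<forall>\<omega>. B u \<omega> = g (increments t m \<omega>)"
    using B_via_increments[OF t] Cons.prems[of u] by (metis list.set_intros(1))
  ultimately show ?case by (intro exI[of _ "g # gs"]) simp
qed simp

text \<open>A cylinder variable is given by values of the path at times in arbitrary order. Sorting
  the times and passing to increments gives it a G-expectation, which is what makes it integrable
  under the representing measures.\<close>

lemma cyl_gexp_exists:
  assumes "X \<in> Lip s"
  shows "\<exists>r. cyl_gexp E \<xi> X r"
proof -
  obtain \<phi> ts where ts: "ts \<noteq> []" "set ts \<subseteq> {0..s}" "\<phi> \<in> Cllip (length ts)"
    "X = (\<lambda>\<omega>. \<phi> (map (\<lambda>u. B u \<omega>) ts))"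
    using Lip_cases[OF assms] by metis
  then have "0 \<le> s" by (cases ts) auto
  then obtain m t where t: "1 \<le> m" "time_grid m t" "\<And>u. u \<in> set ts \<Longrightarrow> \<exists>i\<le>m. t i = u"
    using time_grid_through[OF ts(2)] by metis
  obtain gs where gs: "length gs = length ts" "set gs \<subseteq> Cllip m"
    "\<forall>\<omega>. map (\<lambda>u. B u \<omega>) ts = map (\<lambda>g. g (increments t m \<omega>)) gs"
    using vector_via_increments[OF t(2,3)] by blast
  have "(\<lambda>x. \<phi> (map (\<lambda>g. g x) gs)) \<in> Cllip m" by (rule Cllip_comp) (use gs ts in auto)
  then show ?thesis unfolding cyl_gexp_def using t(1,2) gs(3) ts(4) by auto
qed

lemma continuous_on_B: 
  assumes "0 \<le> u"
  shows "continuous_on UNIV (B u)"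
  unfolding continuous_on_open_vimage[OF open_UNIV]
proof (intro allI impI)
  fix U :: "real set" assume U: "open U"
  show "open (B u -` U \<inter> UNIV)" unfolding open_C0_def
  proof
    fix \<omega> assume "\<omega> \<in> B u -` U \<inter> UNIV"
    then obtain d where d: "d > 0" "\<And>y. \<bar>y - B u \<omega>\<bar> < d \<Longrightarrow> y \<in> U"
      using U unfolding open_dist by (auto simp: dist_real_def)
    then show "\<exists>T d. d > 0 \<and> {\<omega>'. \<forall>t\<in>{0..T}. \<bar>path_fun \<omega>' t - path_fun \<omega> t\<bar> < d} \<subseteq> B u -` U \<inter> UNIV"
      using assms by (intro exI[of _ u] exI[of _ d]) (auto simp: B_def)
  qed
qed

lemma Lip_measurable: "X \<in> Lip s \<Longrightarrow> X \<in> borel_measurable borel"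
proof (erule Lip_cases)
  fix \<phi> ts assume ts: "set ts \<subseteq> {0..s}" "\<phi> \<in> Cllip (length ts)"
    and X: "X = (\<lambda>\<omega>. \<phi> (map (\<lambda>u. B u \<omega>) ts))"
  have "continuous_on UNIV (\<lambda>\<omega>. \<phi> (map (\<lambda>g. g \<omega>) (map B ts)))"
    by (rule Cllip_continuous_comp) (use ts in \<open>auto intro!: continuous_on_B\<close>)
  then show "X \<in> borel_measurable borel"
    by (intro borel_measurable_continuous_onI) (simp add: X comp_def)
qed

lemma Cllip_scale:
  assumes "f \<in> Cllip m" "length cs = m"
  shows "(\<lambda>z. f (map2 (*) cs z)) \<in> Cllip m"
proof -
  have "(\<lambda>z. f (map (\<lambda>g. g z) (map (\<lambda>i z. cs ! i * z ! i) [0..<m]))) \<in> Cllip m"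
    by (rule Cllip_comp) (use assms in \<open>auto intro!: Cllip_mult Cllip_nth\<close>)
  then show ?thesis
    by (rule Cllip_cong) (use assms(2) in \<open>auto intro!: arg_cong[where f = f] nth_equalityI\<close>)
qed

lemma Cllip_append:
  assumes "f \<in> Cllip (j + k)" "length x = j"
  shows "(\<lambda>y. f (x @ y)) \<in> Cllip k"
proof -
  have "(\<lambda>y. f (map (\<lambda>g. g y) (map (\<lambda>c y. c) x @ map (\<lambda>i y. y ! i) [0..<k]))) \<in> Cllip k"
    by (rule Cllip_comp) (use assms in \<open>auto intro!: Cllip_nth\<close>)
  then show ?thesis
    by (rule Cllip_cong) (auto intro!: arg_cong[where f = f] nth_equalityI simp: nth_append)
qed

lemma map_upt_shift: "map f [j..<m] = map (\<lambda>i. f (j + i)) [0..<m - j]"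
  by (rule nth_equalityI) simp_all

lemma map_upt_split: "map f [0..<j + k] = map f [0..<j] @ map (\<lambda>i. f (j + i)) [0..<k]"
  using map_upt_shift[of f j "j + k"] by (simp add: upt_add_eq_append[of 0 j k])

text \<open>The standard deviations by which the standard normals are multiplied on the grid.\<close>

definition scales :: "(nat \<Rightarrow> real) \<Rightarrow> nat \<Rightarrow> nat \<Rightarrow> real list" where
  "scales t j m = map (\<lambda>i. sqrt (t (Suc i) - t i)) [j..<m]"

lemma length_scales [simp]: "length (scales t j m) = m - j"
  by (simp add: scales_def)

lemma scaled_normals_eq:
  "scaled_normals \<xi> t j m \<omega> = map2 (*) (scales t j m) (map (\<lambda>i. \<xi> i \<omega>) [j..<m])"
  by (simp add: scaled_normals_def scales_def map2_map_map)

context G_normal_sequence_space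
begin

lemma E_scaled_normals:
  assumes "f \<in> Cllip (m - j)" "j \<le> m"
  shows "E (\<lambda>\<omega>. f (scaled_normals \<xi> t j m \<omega>)) = nested law (m - j) (\<lambda>z. f (map2 (*) (scales t j m) z))"
  using E_block[OF Cllip_scale[OF assms(1)], of "scales t j m" j] assms(2)
  by (simp add: scaled_normals_eq)

text \<open>The function defining the conditional expectation, in a form that depends on the grid after
  \<open>t j\<close> only through the lengths of its intervals.\<close>

lemma cond_integrand:
  fixes t :: "nat \<Rightarrow> real"
  assumes \<phi>: "\<phi> \<in> Cllip m" and "j \<le> m"
  defines "\<psi> \<equiv> \<lambda>x. E (\<lambda>\<omega>. \<phi> (x @ scaled_normals \<xi> t j m \<omega>))"
  shows "\<And>x. length x = j \<Longrightarrow> \<psi> x = nested law (m - j) (\<lambda>z. \<phi> (x @ map2 (*) (scales t j m) z))"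
    and "\<psi> \<in> Cllip j"
proof -
  show 1: "\<psi> x = nested law (m - j) (\<lambda>z. \<phi> (x @ map2 (*) (scales t j m) z))" if "length x = j" for x
    unfolding \<psi>_def using that assms by (intro E_scaled_normals Cllip_append[of \<phi> j]) auto
  \<comment> \<open>The first \<open>j\<close> coordinates are kept as they are.\<close>
  define cs where "cs = replicate j 1 @ scales t j m"
  have "(\<lambda>w. \<phi> (map2 (*) cs w)) \<in> Cllip (j + (m - j))"
    using assms(1,2) by (intro Cllip_scale) (auto simp: cs_def)
  from Cllip_nested[OF this] show "\<psi> \<in> Cllip j"
  proof (rule Cllip_cong)
    fix x :: "real list" assume x: "length x = j"
    have "map2 (*) (replicate j 1) x = x"
      using x by (auto intro!: nth_equalityI)
    then show "nested law (m - j) (\<lambda>y. \<phi> (map2 (*) cs (x @ y))) = \<psi> x"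
      using x by (simp add: 1 cs_def)
  qed
qed

text \<open>The grid on which the conditional expectation is computed need not contain the times at which
  the test variable \<open>Z\<close> looks. Both are expressed on a refinement that changes the grid only
  up to time \<open>s\<close>; this shifts the indices of the normal variables used after \<open>s\<close>, which
  is harmless because blocks of equal length have the same distribution.\<close>

theorem cond_gexp_tested:
  assumes XY: "cyl_cond_gexp E \<xi> s X Y" and Z: "Z \<in> Lip s" and Z0: "\<And>\<omega>. 0 \<le> Z \<omega>"
  shows "cyl_gexp E \<xi> (\<lambda>\<omega>. (X \<omega> - Y \<omega>) * Z \<omega>) 0"
proof -
  obtain m t \<phi> j where m: "m \<ge> 1" and t: "time_grid m t" and \<phi>: "\<phi> \<in> Cllip m" and j: "j \<le> m" "t j = s"
    and X: "X = (\<lambda>\<omega>. \<phi> (increments t m \<omega>))"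
    and Y: "Y = (\<lambda>\<omega>. E (\<lambda>\<omega>'. \<phi> (increments t j \<omega> @ scaled_normals \<xi> t j m \<omega>')))"
    using XY unfolding cyl_cond_gexp_def by blast
  obtain \<rho> ts where ts: "ts \<noteq> []" "set ts \<subseteq> {0..s}" "\<rho> \<in> Cllip (length ts)"
    and Z_eq: "Z = (\<lambda>\<omega>. \<rho> (map (\<lambda>u. B u \<omega>) ts))"
    using Lip_cases[OF Z] by metis
  define k where "k = m - j"
  have s: "0 \<le> s" using time_grid_nonneg[OF t j(1)] j(2) by simp
  define old where "old = map t [0..<Suc j]"
  have old: "set old \<subseteq> {0..s}"
    using time_grid_mono[OF t _ j(1)] time_grid_nonneg[OF t] j by (auto simp: old_def)
  obtain j' g where g: "1 \<le> j'" "time_grid j' g" "g j' = s"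
    "\<And>u. u \<in> set (old @ ts) \<Longrightarrow> \<exists>i\<le>j'. g i = u"
    using time_grid_through[of "old @ ts" s] old ts(2) s by auto
  define t' where "t' = (\<lambda>i. if i \<le> j' then g i else t (j + (i - j')))"
  define m' where "m' = j' + k"
  have t'_tail: "t' (j' + i) = t (j + i)" for i
    using g(3) j(2) by (cases i) (auto simp: t'_def)
  have t'_head: "t' i = g i" if "i \<le> j'" for i using that by (simp add: t'_def)
  have t': "time_grid m' t'"
    unfolding time_grid_def
  proof (intro conjI allI impI)
    show "t' 0 = 0" using g(2) by (simp add: t'_def time_grid_def)
    fix i assume i: "i < m'"
    show "t' i \<le> t' (Suc i)"
    proof (cases "i < j'")
      case True
      then show ?thesis using g(2) by (simp add: t'_def time_grid_def)
    next
      case False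
      then obtain l where l: "i = j' + l" by (metis le_add_diff_inverse not_less)
      then have "j + l < m" using i j(1) by (simp add: m'_def k_def)
      then have "t (j + l) \<le> t (Suc (j + l))" using t by (simp add: time_grid_def)
      then show ?thesis using t'_tail[of l] t'_tail[of "Suc l"] by (simp add: l)
    qed
  qed
  obtain hs where hs: "length hs = length old" "set hs \<subseteq> Cllip j'"
    "\<And>\<omega>. map (\<lambda>u. B u \<omega>) old = map (\<lambda>h. h (increments g j' \<omega>)) hs"
    using vector_via_increments[OF g(2), of old] g(4) by auto
  obtain ks where ks: "length ks = length ts" "set ks \<subseteq> Cllip j'"
    "\<And>\<omega>. map (\<lambda>u. B u \<omega>) ts = map (\<lambda>h. h (increments g j' \<omega>)) ks"
    using vector_via_increments[OF g(2), of ts] g(4) by auto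
  \<comment> \<open>The old increments up to \<open>s\<close> as functions of the new ones.\<close>
  define rs where "rs = map (\<lambda>i x. (hs ! Suc i) x - (hs ! i) x) [0..<j]"
  define R where "R = (\<lambda>x. map (\<lambda>r. r x) rs)"
  have rs: "set rs \<subseteq> Cllip j'" "length rs = j"
    using hs(1,2) by (auto simp: rs_def old_def intro!: Cllip_diff)
  have R_len [simp]: "length (R x) = j" for x by (simp add: R_def rs(2))
  have R: "increments t j \<omega> = R (increments g j' \<omega>)" for \<omega>
  proof -
    have "B (t i) \<omega> = (hs ! i) (increments g j' \<omega>)" if "i \<le> j" for i
    proof -
      have "map (\<lambda>u. B u \<omega>) old ! i = map (\<lambda>h. h (increments g j' \<omega>)) hs ! i" by (simp add: hs(3))
      then show ?thesis using that hs(1) by (simp add: old_def del: upt_Suc)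
    qed
    then show ?thesis by (simp add: increments_def R_def rs_def)
  qed
  \<comment> \<open>The truncation changes nothing along paths, but makes the factor nonnegative on all vectors.\<close>
  define \<zeta> where "\<zeta> = (\<lambda>x. max 0 (\<rho> (map (\<lambda>h. h x) ks)))"
  have "(\<lambda>x. \<rho> (map (\<lambda>h. h x) ks)) \<in> Cllip j'"
    by (rule Cllip_comp) (use ts(3) ks(1,2) in auto)
  then have \<zeta>: "\<zeta> \<in> Cllip j'" "\<And>x. 0 \<le> \<zeta> x"
    unfolding \<zeta>_def by (intro Cllip_max Cllip_const) simp_all
  have Z\<zeta>: "Z \<omega> = \<zeta> (increments g j' \<omega>)" for \<omega>
    using Z0[of \<omega>] by (simp add: \<zeta>_def Z_eq ks(3)[symmetric])
  define \<psi> where "\<psi> = (\<lambda>x. E (\<lambda>\<omega>. \<phi> (x @ scaled_normals \<xi> t j m \<omega>)))"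
  have \<psi>: "\<psi> x = nested law (m - j) (\<lambda>z. \<phi> (x @ map2 (*) (scales t j m) z))" if "length x = j" for x
    unfolding \<psi>_def by (rule cond_integrand(1)[OF \<phi> j(1) that])
  have \<psi>_mem: "\<psi> \<in> Cllip j" unfolding \<psi>_def by (rule cond_integrand(2)[OF \<phi> j(1)])
  define \<phi>' where "\<phi>' = (\<lambda>z. \<phi> (R (take j' z) @ drop j' z))"
  define \<Phi> where "\<Phi> = (\<lambda>z. (\<phi>' z - \<psi> (R (take j' z))) * \<zeta> (take j' z))"
  have \<phi>': "\<phi>' \<in> Cllip m'"
  proof -
    have "(\<lambda>z. \<phi> (map (\<lambda>g. g z) (map (\<lambda>r z. r (take j' z)) rs @ map (\<lambda>i z. z ! (j' + i)) [0..<k])))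
        \<in> Cllip m'"
      by (rule Cllip_comp)
        (use \<phi> rs j(1) in \<open>auto simp: m'_def k_def intro!: Cllip_nth Cllip_take\<close>)
    then show ?thesis
    proof (rule Cllip_cong)
      fix z :: "real list" assume "length z = m'"
      then have "map (\<lambda>i. z ! (j' + i)) [0..<k] = drop j' z"
        by (intro nth_equalityI) (auto simp: m'_def)
      then show "\<phi> (map (\<lambda>g. g z) (map (\<lambda>r z. r (take j' z)) rs @ map (\<lambda>i z. z ! (j' + i)) [0..<k]))
          = \<phi>' z"
        by (simp add: \<phi>'_def R_def comp_def)
    qed
  qed
  have "(\<lambda>x. \<psi> (R x)) \<in> Cllip j'"
    unfolding R_def by (rule Cllip_comp) (use rs \<psi>_mem in auto)
  then have \<Phi>: "\<Phi> \<in> Cllip m'"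
    unfolding \<Phi>_def using \<phi>' \<zeta>(1)
    by (intro Cllip_mult Cllip_diff Cllip_take[of "\<lambda>x. \<psi> (R x)"] Cllip_take[of \<zeta>])
      (auto simp: m'_def)
  have inc: "increments t m \<omega> = increments t j \<omega> @ map (\<lambda>i. B (t (Suc (j + i))) \<omega> - B (t (j + i)) \<omega>) [0..<k]"
    "increments t' m' \<omega> = increments g j' \<omega> @ map (\<lambda>i. B (t (Suc (j + i))) \<omega> - B (t (j + i)) \<omega>) [0..<k]"
    for \<omega>
  proof -
    show "increments t m \<omega> = increments t j \<omega> @ map (\<lambda>i. B (t (Suc (j + i))) \<omega> - B (t (j + i)) \<omega>) [0..<k]"
      using j(1) map_upt_split[of "\<lambda>i. B (t (Suc i)) \<omega> - B (t i) \<omega>" j k]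
      by (simp add: increments_def k_def)
    have "t' (Suc (j' + i)) = t (Suc (j + i))" for i using t'_tail[of "Suc i"] by simp
    then show "increments t' m' \<omega> =
        increments g j' \<omega> @ map (\<lambda>i. B (t (Suc (j + i))) \<omega> - B (t (j + i)) \<omega>) [0..<k]"
      using t'_tail t'_head map_upt_split[of "\<lambda>i. B (t' (Suc i)) \<omega> - B (t' i) \<omega>" j' k]
      by (simp add: increments_def m'_def)
  qed
  have len_g: "length (increments g j' \<omega>) = j'" for \<omega> by (simp add: increments_def)
  have "(X \<omega> - Y \<omega>) * Z \<omega> = \<Phi> (increments t' m' \<omega>)" for \<omega>
    by (simp add: X Y Z\<zeta> \<Phi>_def \<phi>'_def \<psi>_def inc len_g R[symmetric])
  moreover have "E (\<lambda>\<omega>. \<Phi> (scaled_normals \<xi> t' 0 m' \<omega>)) = 0"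
  proof -
    define c1 where "c1 = scales t' 0 j'"
    define c2 where "c2 = scales t j m"
    have c: "length c1 = j'" "length c2 = k" by (simp_all add: c1_def c2_def k_def)
    have c12: "scales t' 0 m' = c1 @ c2"
    proof -
      have "t' (Suc (j' + i)) = t (Suc (j + i))" for i using t'_tail[of "Suc i"] by simp
      then show ?thesis
        using t'_tail map_upt_split[of "\<lambda>i. sqrt (t' (Suc i) - t' i)" j' k]
          map_upt_shift[of "\<lambda>i. sqrt (t (Suc i) - t i)" j m]
        by (simp add: c1_def c2_def scales_def m'_def k_def)
    qed
    define sc1 where "sc1 = map2 (*) c1"
    define sc2 where "sc2 = map2 (*) c2"
    have split: "map2 (*) (c1 @ c2) z = sc1 (take j' z) @ sc2 (drop j' z)" if "length z = m'" for z
      using zip_append1[of c1 c2 z] c by (simp add: sc1_def sc2_def)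
    have len1: "length (sc1 x) = j'" if "length x = j'" for x using that c by (simp add: sc1_def)
    have "E (\<lambda>\<omega>. \<Phi> (scaled_normals \<xi> t' 0 m' \<omega>)) = nested law m' (\<lambda>z. \<Phi> (map2 (*) (c1 @ c2) z))"
      using E_scaled_normals[of \<Phi> m' 0 t'] \<Phi> by (simp add: c12)
    also have "\<dots> = nested law (j' + k) (\<lambda>z. (\<phi> (R (sc1 (take j' z)) @ sc2 (drop j' z))
        - \<psi> (R (sc1 (take j' z)))) * \<zeta> (sc1 (take j' z)))"
      unfolding m'_def
      by (rule nested_cong) (simp add: split m'_def \<Phi>_def \<phi>'_def len1)
    also have "\<dots> = 0"
    proof (rule nested_centred[where \<phi> = "\<lambda>z. \<phi> (R (sc1 (take j' z)) @ sc2 (drop j' z))"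
          and \<psi> = "\<lambda>x. \<psi> (R (sc1 x))" and \<zeta> = "\<lambda>x. \<zeta> (sc1 x)"])
      fix x :: "real list" assume x: "length x = j'"
      have "(\<lambda>y. \<phi> (R (sc1 x) @ y)) \<in> Cllip k"
        by (rule Cllip_append[of \<phi> j]) (use \<phi> j(1) in \<open>simp_all add: k_def\<close>)
      from Cllip_scale[OF this c(2)] have "(\<lambda>y. \<phi> (R (sc1 x) @ sc2 y)) \<in> Cllip k"
        by (simp add: sc2_def)
      then show "(\<lambda>y. \<phi> (R (sc1 (take j' (x @ y))) @ sc2 (drop j' (x @ y)))) \<in> Cllip k"
        using x by simp
      show "\<psi> (R (sc1 x)) =
          nested law k (\<lambda>y. \<phi> (R (sc1 (take j' (x @ y))) @ sc2 (drop j' (x @ y))))"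
        using x \<psi>[of "R (sc1 x)"] by (simp add: sc2_def c2_def k_def)
    next
      fix x show "0 \<le> \<zeta> (sc1 x)" by (rule \<zeta>(2))
    qed
    finally show ?thesis .
  qed
  moreover have "1 \<le> m'" using g(1) by (simp add: m'_def)
  ultimately show ?thesis
    unfolding cyl_gexp_def using t' \<Phi> by (intro exI[of _ m'] exI[of _ t'] exI[of _ \<Phi>]) auto
qed

lemma cond_gexp_Lip:
  assumes "cyl_cond_gexp E \<xi> s X Y"
  shows "0 \<le> s" and "Y \<in> Lip s" and "\<exists>T. X \<in> Lip T"
proof -
  obtain m t \<phi> j where t: "time_grid m t" and \<phi>: "\<phi> \<in> Cllip m" and j: "j \<le> m" "t j = s"
    and X: "X = (\<lambda>\<omega>. \<phi> (increments t m \<omega>))"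
    and Y: "Y = (\<lambda>\<omega>. E (\<lambda>\<omega>'. \<phi> (increments t j \<omega> @ scaled_normals \<xi> t j m \<omega>')))"
    using assms unfolding cyl_cond_gexp_def by blast
  have tj: "time_grid j t" using t j by (simp add: time_grid_def)
  show "0 \<le> s" using time_grid_nonneg[OF t j(1)] j(2) by simp
  show "Y \<in> Lip s" unfolding Y
    using increments_Lip[OF tj cond_integrand(2)[OF \<phi> j(1), of t]] j(2) by simp
  show "\<exists>T. X \<in> Lip T" unfolding X using increments_Lip[OF t \<phi>] by blast
qed

end

section \<open>Representing measures\<close>

lemma ext_expectation_nonneg:
  assumes "\<And>\<omega>. 0 \<le> X \<omega>"
  shows "ext_expectation P X = enn2ereal (\<integral>\<^sup>+\<omega>. ennreal (X \<omega>) \<partial>P)"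
proof -
  have "(\<integral>\<^sup>+\<omega>. ennreal (- X \<omega>) \<partial>P) = (\<integral>\<^sup>+\<omega>. 0 \<partial>P)"
    by (intro nn_integral_cong) (use assms in \<open>simp add: ennreal_neg\<close>)
  then show ?thesis by (simp add: ext_expectation_def zero_ennreal.rep_eq zero_ereal_def[symmetric])
qed

lemma ext_expectation_integrable:
  assumes "integrable P X"
  shows "ext_expectation P X = ereal (\<integral>\<omega>. X \<omega> \<partial>P)"
proof -
  have "(\<integral>\<^sup>+\<omega>. ennreal (X \<omega>) \<partial>P) < \<top>" "(\<integral>\<^sup>+\<omega>. ennreal (- X \<omega>) \<partial>P) < \<top>"
    using assms by (auto simp: real_integrable_def less_top)
  then obtain p q where pq: "0 \<le> p" "(\<integral>\<^sup>+\<omega>. ennreal (X \<omega>) \<partial>P) = ennreal p"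
    "0 \<le> q" "(\<integral>\<^sup>+\<omega>. ennreal (- X \<omega>) \<partial>P) = ennreal q"
    by (metis ennreal_cases less_irrefl infinity_ennreal_def)
  then show ?thesis
    by (simp add: ext_expectation_def real_lebesgue_integral_def[OF assms])
qed

lemma ext_expectation_le_upper_exp: "P \<in> \<P> \<Longrightarrow> ext_expectation P X \<le> upper_exp \<P> X"
  unfolding upper_exp_def by (rule SUP_upper)

locale G_expectation_measure = G_normal_sequence_space H E \<sigma>\<^sub>0 \<xi>
  for H :: "('b \<Rightarrow> real) set" and E :: "('b \<Rightarrow> real) \<Rightarrow> real" and \<sigma>\<^sub>0 :: real
    and \<xi> :: "nat \<Rightarrow> 'b \<Rightarrow> real" +
  fixes \<P> :: "C0 measure set" and P :: "C0 measure"
  assumes represents: "represents_gexp E \<xi> \<P>" and P_mem: "P \<in> \<P>"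
begin

lemma sets_P [measurable_cong]: "sets P = sets borel"
  and prob_space_P: "prob_space P"
  using represents P_mem by (auto simp: represents_gexp_def prob_measures_def)

sublocale P: prob_space P by (rule prob_space_P)

lemma space_P [simp]: "space P = UNIV"
  using sets_eq_imp_space_eq[OF sets_P] by simp

lemma quasi_surely_AE:
  assumes "quasi_surely \<P> Q"
  shows "AE \<omega> in P. Q \<omega>"
proof -
  obtain N where N: "N \<in> sets borel" "capacity \<P> N = 0" "\<And>\<omega>. \<omega> \<notin> N \<Longrightarrow> Q \<omega>"
    using assms unfolding quasi_surely_def by blast
  have "emeasure P N \<le> capacity \<P> N" unfolding capacity_def by (rule SUP_upper[OF P_mem])
  then show ?thesis using N by (intro AE_I[of _ _ N]) (auto simp: sets_P)
qed

lemma Lip_integrable: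
  assumes X: "X \<in> Lip s" and s: "0 \<le> s"
  shows "integrable P X"
proof (rule integrableI_bounded)
  show "X \<in> borel_measurable P" using Lip_measurable[OF X] by measurable
  have "(\<lambda>l. \<bar>l ! 0\<bar>) \<in> Cllip 1" by (intro Cllip_abs Cllip_nth) simp
  from Lip_comp1[OF s X this] obtain r where "cyl_gexp E \<xi> (\<lambda>\<omega>. \<bar>X \<omega>\<bar>) r"
    using cyl_gexp_exists by metis
  then have "upper_exp \<P> (\<lambda>\<omega>. \<bar>X \<omega>\<bar>) = ereal r"
    using represents by (simp add: represents_gexp_def)
  then have "enn2ereal (\<integral>\<^sup>+\<omega>. ennreal \<bar>X \<omega>\<bar> \<partial>P) \<le> ereal r"
    using ext_expectation_le_upper_exp[OF P_mem, of "\<lambda>\<omega>. \<bar>X \<omega>\<bar>"] by (simp add: ext_expectation_nonneg)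
  then show "(\<integral>\<^sup>+\<omega>. ennreal (norm (X \<omega>)) \<partial>P) < \<infinity>"
    by (cases "\<integral>\<^sup>+\<omega>. ennreal \<bar>X \<omega>\<bar> \<partial>P") auto
qed

lemma integral_le_cyl_gexp:
  assumes "cyl_gexp E \<xi> X r" "integrable P X"
  shows "(\<integral>\<omega>. X \<omega> \<partial>P) \<le> r"
proof -
  have "upper_exp \<P> X = ereal r" using represents assms(1) by (simp add: represents_gexp_def)
  then show ?thesis
    using ext_expectation_le_upper_exp[OF P_mem, of X] ext_expectation_integrable[OF assms(2)] by simp
qed

lemma L1_limit:
  assumes X: "X \<in> borel_measurable borel" and Xn: "\<And>n::nat. integrable P (Xn n)"
    and lim: "(\<lambda>n. upper_exp \<P> (\<lambda>\<omega>. \<bar>Xn n \<omega> - X \<omega>\<bar>)) \<longlonglongrightarrow> 0"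
  shows "integrable P X" and "(\<lambda>n. \<integral>\<omega>. \<bar>Xn n \<omega> - X \<omega>\<bar> \<partial>P) \<longlonglongrightarrow> 0"
proof -
  have [measurable]: "X \<in> borel_measurable P" using X by measurable
  have [measurable]: "Xn n \<in> borel_measurable P" for n using Xn by (rule borel_measurable_integrable)
  have le: "ext_expectation P (\<lambda>\<omega>. \<bar>Xn n \<omega> - X \<omega>\<bar>) \<le> upper_exp \<P> (\<lambda>\<omega>. \<bar>Xn n \<omega> - X \<omega>\<bar>)" for n
    by (rule ext_expectation_le_upper_exp[OF P_mem])
  have "eventually (\<lambda>n. upper_exp \<P> (\<lambda>\<omega>. \<bar>Xn n \<omega> - X \<omega>\<bar>) < 1) sequentially"
    by (rule order_tendstoD(2)[OF lim]) simp
  then obtain n where "upper_exp \<P> (\<lambda>\<omega>. \<bar>Xn n \<omega> - X \<omega>\<bar>) < 1"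
    by (auto simp: eventually_sequentially)
  then have "enn2ereal (\<integral>\<^sup>+\<omega>. ennreal \<bar>Xn n \<omega> - X \<omega>\<bar> \<partial>P) < 1"
    using le[of n] by (simp add: ext_expectation_nonneg)
  then have "integrable P (\<lambda>\<omega>. Xn n \<omega> - X \<omega>)"
    by (intro integrableI_bounded)
      (measurable, cases "\<integral>\<^sup>+\<omega>. ennreal \<bar>Xn n \<omega> - X \<omega>\<bar> \<partial>P", auto)
  then have "integrable P (\<lambda>\<omega>. Xn n \<omega> - (Xn n \<omega> - X \<omega>))"
    by (rule Bochner_Integration.integrable_diff[OF Xn])
  then show X_int: "integrable P X" by simp
  have "(\<lambda>n. ereal (\<integral>\<omega>. \<bar>Xn n \<omega> - X \<omega>\<bar> \<partial>P)) \<longlonglongrightarrow> 0"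
  proof (rule tendsto_sandwich[OF _ _ tendsto_const lim])
    show "\<forall>\<^sub>F n in sequentially. 0 \<le> ereal (\<integral>\<omega>. \<bar>Xn n \<omega> - X \<omega>\<bar> \<partial>P)"
      by (intro always_eventually allI) simp
    show "\<forall>\<^sub>F n in sequentially. ereal (\<integral>\<omega>. \<bar>Xn n \<omega> - X \<omega>\<bar> \<partial>P) \<le> upper_exp \<P> (\<lambda>\<omega>. \<bar>Xn n \<omega> - X \<omega>\<bar>)"
    proof (intro always_eventually allI)
      fix n
      have "integrable P (\<lambda>\<omega>. \<bar>Xn n \<omega> - X \<omega>\<bar>)" using Xn X_int by simp
      from ext_expectation_integrable[OF this] le[of n]
      show "ereal (\<integral>\<omega>. \<bar>Xn n \<omega> - X \<omega>\<bar> \<partial>P) \<le> upper_exp \<P> (\<lambda>\<omega>. \<bar>Xn n \<omega> - X \<omega>\<bar>)" by simp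
    qed
  qed
  then show "(\<lambda>n. \<integral>\<omega>. \<bar>Xn n \<omega> - X \<omega>\<bar> \<partial>P) \<longlonglongrightarrow> 0"
    by (simp add: zero_ereal_def)
qed

lemma LG1_approximation:
  assumes "X \<in> LG1 \<P> s" "0 \<le> s"
  shows "integrable P X"
    and "\<exists>Xn. (\<forall>n. Xn n \<in> Lip s) \<and> (\<lambda>n. \<integral>\<omega>. \<bar>Xn n \<omega> - X \<omega>\<bar> \<partial>P) \<longlonglongrightarrow> 0"
proof -
  obtain Xn where Xn: "\<And>n. Xn n \<in> Lip s" "X \<in> borel_measurable borel"
      "(\<lambda>n. upper_exp \<P> (\<lambda>\<omega>. \<bar>Xn n \<omega> - X \<omega>\<bar>)) \<longlonglongrightarrow> 0"
    using assms(1) unfolding L1_completion_def by blast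
  note lim = L1_limit[OF Xn(2) Lip_integrable[OF Xn(1) assms(2)] Xn(3)]
  show "integrable P X" by (rule lim(1))
  show "\<exists>Xn. (\<forall>n. Xn n \<in> Lip s) \<and> (\<lambda>n. \<integral>\<omega>. \<bar>Xn n \<omega> - X \<omega>\<bar> \<partial>P) \<longlonglongrightarrow> 0"
    using Xn(1) lim(2) by blast
qed

lemma LG1_uminus: "X \<in> LG1 \<P> s \<Longrightarrow> 0 \<le> s \<Longrightarrow> (\<lambda>\<omega>. - X \<omega>) \<in> LG1 \<P> s"
proof -
  assume "X \<in> LG1 \<P> s" "0 \<le> s"
  then obtain Xn where Xn: "\<And>n. Xn n \<in> Lip s" "X \<in> borel_measurable borel"
      "(\<lambda>n. upper_exp \<P> (\<lambda>\<omega>. \<bar>Xn n \<omega> - X \<omega>\<bar>)) \<longlonglongrightarrow> 0"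
    unfolding L1_completion_def by blast
  have "(\<lambda>l. 0 - l ! 0 :: real) \<in> Cllip 1" by (intro Cllip_diff Cllip_nth Cllip_const) simp
  from Lip_comp1[OF \<open>0 \<le> s\<close> Xn(1) this] have "(\<lambda>\<omega>. - Xn n \<omega>) \<in> Lip s" for n by simp
  moreover have "\<bar>- Xn n \<omega> - - X \<omega>\<bar> = \<bar>Xn n \<omega> - X \<omega>\<bar>" for n \<omega> by simp
  ultimately show "(\<lambda>\<omega>. - X \<omega>) \<in> LG1 \<P> s"
    unfolding L1_completion_def using Xn(2,3)
    by (auto intro!: exI[of _ "\<lambda>n \<omega>. - Xn n \<omega>"])
qed

text \<open>Under a single representing measure the conditional G-expectation \<open>Y\<close> dominates the ordinary
  conditional expectation of \<open>X\<close>, here tested against cylinder variables. For cylinder \<open>X\<close> the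
  G-expectation of \<open>(X - Y) Z\<close> vanishes, and it bounds the expectation under each representing measure;
  the general case follows by passing to the \<open>L\<^sup>1\<close> limit, as \<open>Z\<close> is bounded.\<close>

theorem cond_gexp_dominates:
  assumes XY: "has_cond_gexp E \<xi> \<P> s X Y"
    and Z: "Z \<in> Lip s" "\<And>\<omega>. 0 \<le> Z \<omega>" "\<And>\<omega>. Z \<omega> \<le> 1"
  shows "integrable P X" and "integrable P Y" and "(\<integral>\<omega>. (X \<omega> - Y \<omega>) * Z \<omega> \<partial>P) \<le> 0"
proof -
  obtain Xn Yn where c: "\<And>n::nat. cyl_cond_gexp E \<xi> s (Xn n) (Yn n)"
    and limX: "(\<lambda>n. upper_exp \<P> (\<lambda>\<omega>. \<bar>Xn n \<omega> - X \<omega>\<bar>)) \<longlonglongrightarrow> 0"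
    and limY: "(\<lambda>n. upper_exp \<P> (\<lambda>\<omega>. \<bar>Yn n \<omega> - Y \<omega>\<bar>)) \<longlonglongrightarrow> 0"
    and meas: "X \<in> borel_measurable borel" "Y \<in> borel_measurable borel"
    using XY unfolding has_cond_gexp_def L1_completion_def by blast
  have s: "0 \<le> s" by (rule cond_gexp_Lip(1)[OF c[of 0]])
  have Yn: "integrable P (Yn n)" for n
    using cond_gexp_Lip(2)[OF c[of n]] s by (rule Lip_integrable)
  have Xn: "integrable P (Xn n)" for n
  proof -
    obtain T where "Xn n \<in> Lip T" using cond_gexp_Lip(3)[OF c[of n]] by blast
    then show ?thesis using Lip_mono[of T "max 0 T"] by (intro Lip_integrable[of _ "max 0 T"]) auto
  qed
  have intX: "integrable P X" and limX': "(\<lambda>n. \<integral>\<omega>. \<bar>Xn n \<omega> - X \<omega>\<bar> \<partial>P) \<longlonglongrightarrow> 0"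
    using L1_limit[OF meas(1) Xn limX] by auto
  have intY: "integrable P Y" and limY': "(\<lambda>n. \<integral>\<omega>. \<bar>Yn n \<omega> - Y \<omega>\<bar> \<partial>P) \<longlonglongrightarrow> 0"
    using L1_limit[OF meas(2) Yn limY] by auto
  show "integrable P X" "integrable P Y" by fact+
  have Zm [measurable]: "Z \<in> borel_measurable P" using Lip_measurable[OF Z(1)] by measurable
  have mult: "integrable P (\<lambda>\<omega>. W \<omega> * Z \<omega>)" if "integrable P W" for W
  proof (rule Bochner_Integration.integrable_bound[OF that])
    show "(\<lambda>\<omega>. W \<omega> * Z \<omega>) \<in> borel_measurable P" using that by measurable
    show "AE \<omega> in P. norm (W \<omega> * Z \<omega>) \<le> norm (W \<omega>)"
      using Z(2,3) by (auto simp: abs_mult intro!: mult_right_le_one_le)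
  qed
  have "(\<integral>\<omega>. (X \<omega> - Y \<omega>) * Z \<omega> \<partial>P) \<le> (\<integral>\<omega>. \<bar>Xn n \<omega> - X \<omega>\<bar> \<partial>P) + (\<integral>\<omega>. \<bar>Yn n \<omega> - Y \<omega>\<bar> \<partial>P)" for n
  proof -
    have "(\<integral>\<omega>. (X \<omega> - Y \<omega>) * Z \<omega> \<partial>P) \<le>
        (\<integral>\<omega>. (Xn n \<omega> - Yn n \<omega>) * Z \<omega> + (\<bar>Xn n \<omega> - X \<omega>\<bar> + \<bar>Yn n \<omega> - Y \<omega>\<bar>) \<partial>P)"
    proof (rule integral_mono)
      show "integrable P (\<lambda>\<omega>. (X \<omega> - Y \<omega>) * Z \<omega>)" using intX intY by (intro mult) simp
      show "integrable P (\<lambda>\<omega>. (Xn n \<omega> - Yn n \<omega>) * Z \<omega> + (\<bar>Xn n \<omega> - X \<omega>\<bar> + \<bar>Yn n \<omega> - Y \<omega>\<bar>))"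
        using intX intY Xn Yn by (intro Bochner_Integration.integrable_add mult) simp_all
      fix \<omega>
      have "(X \<omega> - Y \<omega>) * Z \<omega> - (Xn n \<omega> - Yn n \<omega>) * Z \<omega>
          = ((Yn n \<omega> - Y \<omega>) - (Xn n \<omega> - X \<omega>)) * Z \<omega>" by (simp add: algebra_simps)
      also have "\<dots> \<le> (\<bar>Xn n \<omega> - X \<omega>\<bar> + \<bar>Yn n \<omega> - Y \<omega>\<bar>) * Z \<omega>"
        using Z(2) by (intro mult_right_mono) auto
      also have "\<dots> \<le> \<bar>Xn n \<omega> - X \<omega>\<bar> + \<bar>Yn n \<omega> - Y \<omega>\<bar>"
        using Z(2,3) by (intro mult_right_le_one_le) auto
      finally show "(X \<omega> - Y \<omega>) * Z \<omega> \<le>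
          (Xn n \<omega> - Yn n \<omega>) * Z \<omega> + (\<bar>Xn n \<omega> - X \<omega>\<bar> + \<bar>Yn n \<omega> - Y \<omega>\<bar>)" by linarith
    qed
    also have "\<dots> = (\<integral>\<omega>. (Xn n \<omega> - Yn n \<omega>) * Z \<omega> \<partial>P) +
        ((\<integral>\<omega>. \<bar>Xn n \<omega> - X \<omega>\<bar> \<partial>P) + (\<integral>\<omega>. \<bar>Yn n \<omega> - Y \<omega>\<bar> \<partial>P))"
      using intX intY Xn Yn mult[of "\<lambda>\<omega>. Xn n \<omega> - Yn n \<omega>"] by simp
    also have "(\<integral>\<omega>. (Xn n \<omega> - Yn n \<omega>) * Z \<omega> \<partial>P) \<le> 0"
      using cond_gexp_tested[OF c Z(1,2)] Xn Yn by (intro integral_le_cyl_gexp mult) auto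
    finally show ?thesis by simp
  qed
  then show "(\<integral>\<omega>. (X \<omega> - Y \<omega>) * Z \<omega> \<partial>P) \<le> 0"
    using tendsto_add[OF limX' limY'] by (intro LIMSEQ_le_const[where X = "\<lambda>n. (\<integral>\<omega>. \<bar>Xn n \<omega> - X \<omega>\<bar> \<partial>P) + (\<integral>\<omega>. \<bar>Yn n \<omega> - Y \<omega>\<bar> \<partial>P)"]) auto
qed

section \<open>Events approximable by cylinder variables\<close>

text \<open>These sets stand in for the past up to time \<open>s\<close>: they contain every event that a strategy
  reading a process in \<open>LG1\<close> at times up to \<open>s\<close> can depend on, and inequalities proved for cylinder
  variables pass to their indicators. Closure under Boolean operations is enough, since only finitely
  many observations are combined.\<close>

definition approximable :: "real \<Rightarrow> C0 set \<Rightarrow> bool" where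
  "approximable s A \<longleftrightarrow> A \<in> sets borel \<and> (\<forall>\<epsilon>>0. \<exists>Z\<in>Lip s. (\<forall>\<omega>. 0 \<le> Z \<omega> \<and> Z \<omega> \<le> 1) \<and>
    (\<integral>\<omega>. \<bar>indicator A \<omega> - Z \<omega>\<bar> \<partial>P) < \<epsilon>)"

lemma approximable_mono: "approximable u A \<Longrightarrow> u \<le> s \<Longrightarrow> approximable s A"
  unfolding approximable_def using Lip_mono[of u s] by blast

lemma approximable_Compl:
  assumes A: "approximable s A" and s: "0 \<le> s"
  shows "approximable s (- A)"
  unfolding approximable_def
proof (intro conjI allI impI)
  show "- A \<in> sets borel" using A unfolding approximable_def by auto
  fix \<epsilon> :: real assume "0 < \<epsilon>"
  then obtain Z where Z: "Z \<in> Lip s" "\<And>\<omega>. 0 \<le> Z \<omega> \<and> Z \<omega> \<le> 1"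
    "(\<integral>\<omega>. \<bar>indicator A \<omega> - Z \<omega>\<bar> \<partial>P) < \<epsilon>"
    using A unfolding approximable_def by blast
  have "(\<lambda>l. 1 - l ! 0 :: real) \<in> Cllip 1" by (intro Cllip_diff Cllip_nth Cllip_const) simp
  from Lip_comp1[OF s Z(1) this] have "(\<lambda>\<omega>. 1 - Z \<omega>) \<in> Lip s" .
  moreover have "\<bar>indicator (- A) \<omega> - (1 - Z \<omega>)\<bar> = \<bar>indicator A \<omega> - Z \<omega>\<bar>" for \<omega>
    by (auto simp: indicator_def)
  ultimately show "\<exists>Z\<in>Lip s. (\<forall>\<omega>. 0 \<le> Z \<omega> \<and> Z \<omega> \<le> 1) \<and>
      (\<integral>\<omega>. \<bar>indicator (- A) \<omega> - Z \<omega>\<bar> \<partial>P) < \<epsilon>"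
    using Z(2,3) by (intro bexI[of _ "\<lambda>\<omega>. 1 - Z \<omega>"]) auto
qed

lemma approximable_Int:
  assumes A: "approximable s A" and A': "approximable s A'" and s: "0 \<le> s"
  shows "approximable s (A \<inter> A')"
  unfolding approximable_def
proof (intro conjI allI impI)
  have m: "A \<in> sets borel" "A' \<in> sets borel" using A A' unfolding approximable_def by auto
  then show "A \<inter> A' \<in> sets borel" by auto
  fix \<epsilon> :: real assume "0 < \<epsilon>"
  then have \<epsilon>: "0 < \<epsilon> / 2" by simp
  obtain Z where Z: "Z \<in> Lip s" "\<And>\<omega>. 0 \<le> Z \<omega>" "\<And>\<omega>. Z \<omega> \<le> 1"
    "(\<integral>\<omega>. \<bar>indicator A \<omega> - Z \<omega>\<bar> \<partial>P) < \<epsilon> / 2"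
    using A \<epsilon> unfolding approximable_def by blast
  obtain Z' where Z': "Z' \<in> Lip s" "\<And>\<omega>. 0 \<le> Z' \<omega>" "\<And>\<omega>. Z' \<omega> \<le> 1"
    "(\<integral>\<omega>. \<bar>indicator A' \<omega> - Z' \<omega>\<bar> \<partial>P) < \<epsilon> / 2"
    using A' \<epsilon> unfolding approximable_def by blast
  have "(\<lambda>l. l ! 0 * l ! 1 :: real) \<in> Cllip 2" by (intro Cllip_mult Cllip_nth) simp_all
  from Lip_comp2[OF s Z(1) Z'(1) this] have ZZ: "(\<lambda>\<omega>. Z \<omega> * Z' \<omega>) \<in> Lip s" .
  have ind: "integrable P (indicator C :: C0 \<Rightarrow> real)" if "C \<in> sets borel" for C
    using that by (intro integrable_real_indicator) (auto simp: sets_P P.emeasure_finite less_top[symmetric])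
  have "(\<integral>\<omega>. \<bar>indicator (A \<inter> A') \<omega> - Z \<omega> * Z' \<omega>\<bar> \<partial>P) \<le>
      (\<integral>\<omega>. \<bar>indicator A \<omega> - Z \<omega>\<bar> + \<bar>indicator A' \<omega> - Z' \<omega>\<bar> \<partial>P)"
  proof (rule integral_mono)
    show "integrable P (\<lambda>\<omega>. \<bar>indicator (A \<inter> A') \<omega> - Z \<omega> * Z' \<omega>\<bar>)"
      using ind[of "A \<inter> A'"] m Lip_integrable[OF ZZ s]
      by (intro integrable_abs Bochner_Integration.integrable_diff) auto
    show "integrable P (\<lambda>\<omega>. \<bar>indicator A \<omega> - Z \<omega>\<bar> + \<bar>indicator A' \<omega> - Z' \<omega>\<bar>)"
      using ind m Lip_integrable[OF Z(1) s] Lip_integrable[OF Z'(1) s]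
      by (intro integrable_abs Bochner_Integration.integrable_diff Bochner_Integration.integrable_add) auto
    fix \<omega>
    have "Z \<omega> * Z' \<omega> \<le> Z \<omega>" "Z \<omega> * Z' \<omega> \<le> Z' \<omega>" "0 \<le> Z \<omega> * Z' \<omega>"
      "0 \<le> (1 - Z \<omega>) * (1 - Z' \<omega>)"
      using Z(2,3) Z'(2,3) by (auto intro: mult_left_le_one_le mult_right_le_one_le)
    then show "\<bar>indicator (A \<inter> A') \<omega> - Z \<omega> * Z' \<omega>\<bar> \<le> \<bar>indicator A \<omega> - Z \<omega>\<bar> + \<bar>indicator A' \<omega> - Z' \<omega>\<bar>"
      using Z(2,3)[of \<omega>] Z'(2,3)[of \<omega>] by (auto simp: indicator_def algebra_simps split: if_splits)
  qed
  also have "\<dots> = (\<integral>\<omega>. \<bar>indicator A \<omega> - Z \<omega>\<bar> \<partial>P) + (\<integral>\<omega>. \<bar>indicator A' \<omega> - Z' \<omega>\<bar> \<partial>P)"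
    using ind m Lip_integrable[OF Z(1) s] Lip_integrable[OF Z'(1) s]
    by (intro Bochner_Integration.integral_add integrable_abs Bochner_Integration.integrable_diff) auto
  also have "\<dots> < \<epsilon>" using Z(4) Z'(4) by simp
  finally show "\<exists>Z\<in>Lip s. (\<forall>\<omega>. 0 \<le> Z \<omega> \<and> Z \<omega> \<le> 1) \<and>
      (\<integral>\<omega>. \<bar>indicator (A \<inter> A') \<omega> - Z \<omega>\<bar> \<partial>P) < \<epsilon>"
    using Z(2,3) Z'(2,3) by (intro bexI[OF _ ZZ]) (auto intro: mult_le_one)
qed

lemma approximable_Un:
  assumes "approximable s A" "approximable s A'" "0 \<le> s"
  shows "approximable s (A \<union> A')"
proof -
  have "approximable s (- (- A \<inter> - A'))"
    using assms by (intro approximable_Compl approximable_Int)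
  then show ?thesis by simp
qed

text \<open>Piecewise linear functions decreasing to the indicator of \<open>[c,\<infinity>)\<close>, evaluated at a cylinder
  variable that is close to \<open>X\<close>: the slope is chosen before the cylinder variable.\<close>

lemma approximable_superlevel:
  assumes X: "X \<in> LG1 \<P> s" and s: "0 \<le> s"
  shows "approximable s {\<omega>. c \<le> X \<omega>}"
  unfolding approximable_def
proof (intro conjI allI impI)
  have Xm: "X \<in> borel_measurable borel" using X by (simp add: L1_completion_def)
  then have Xm' [measurable]: "X \<in> borel_measurable P" by measurable
  show m: "{\<omega>. c \<le> X \<omega>} \<in> sets borel" using Xm by measurable
  fix \<epsilon> :: real assume \<epsilon>: "0 < \<epsilon>"
  define h where "h = (\<lambda>(k::nat) x. max 0 (1 - max 0 (real k * (c - x))))"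
  have h: "0 \<le> h k x" "h k x \<le> 1" "\<bar>h k x - h k y\<bar> \<le> real k * \<bar>x - y\<bar>" for k x y
  proof -
    show "0 \<le> h k x" "h k x \<le> 1" by (auto simp: h_def)
    have "\<bar>h k x - h k y\<bar> \<le> \<bar>real k * (c - x) - real k * (c - y)\<bar>" by (auto simp: h_def)
    also have "\<dots> = real k * \<bar>x - y\<bar>"
      by (simp add: right_diff_distrib[symmetric] abs_mult abs_minus_commute)
    finally show "\<bar>h k x - h k y\<bar> \<le> real k * \<bar>x - y\<bar>" .
  qed
  have [measurable]: "h k \<in> borel_measurable borel" for k unfolding h_def by measurable
  let ?A = "{\<omega>. c \<le> X \<omega>}"
  have [measurable]: "?A \<in> sets P" using m by (simp add: sets_P)
  have "(\<lambda>k. \<integral>\<omega>. \<bar>indicator ?A \<omega> - h k (X \<omega>)\<bar> \<partial>P) \<longlonglongrightarrow> (\<integral>\<omega>. 0 \<partial>P)"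
  proof (rule integral_dominated_convergence[where w = "\<lambda>_. 1"])
    show "AE \<omega> in P. (\<lambda>k. \<bar>indicator ?A \<omega> - h k (X \<omega>)\<bar>) \<longlonglongrightarrow> 0"
    proof (rule AE_I2)
      fix \<omega>
      obtain N :: nat where N: "c \<le> X \<omega> \<or> 1 / (c - X \<omega>) \<le> real N" using real_arch_simple by blast
      have "\<bar>indicator ?A \<omega> - h k (X \<omega>)\<bar> = 0" if "k \<ge> N" for k
      proof (cases "c \<le> X \<omega>")
        case True
        then have "real k * (c - X \<omega>) \<le> 0" by (simp add: mult_nonneg_nonpos)
        then show ?thesis using True by (simp add: h_def)
      next
        case False
        then have "1 / (c - X \<omega>) \<le> real k" using N that by linarith
        then have "1 \<le> real k * (c - X \<omega>)" using False by (simp add: field_simps)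
        then show ?thesis using False by (simp add: h_def)
      qed
      then show "(\<lambda>k. \<bar>indicator ?A \<omega> - h k (X \<omega>)\<bar>) \<longlonglongrightarrow> 0"
        by (intro tendsto_eventually) (auto simp: eventually_sequentially)
    qed
    show "AE \<omega> in P. norm \<bar>indicator ?A \<omega> - h k (X \<omega>)\<bar> \<le> 1" for k
    proof (rule AE_I2)
      fix \<omega> show "norm \<bar>indicator ?A \<omega> - h k (X \<omega>)\<bar> \<le> 1"
        using h(1,2)[of k "X \<omega>"] by (auto simp: indicator_def)
    qed
  qed auto
  then have "\<forall>\<^sub>F k in sequentially. (\<integral>\<omega>. \<bar>indicator ?A \<omega> - h k (X \<omega>)\<bar> \<partial>P) < \<epsilon> / 2"
    using \<epsilon> by (intro order_tendstoD(2)[where y = 0]) auto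
  then obtain k where k: "(\<integral>\<omega>. \<bar>indicator ?A \<omega> - h k (X \<omega>)\<bar> \<partial>P) < \<epsilon> / 2"
    by (auto simp: eventually_sequentially)
  obtain Xn where Xn: "\<And>n. Xn n \<in> Lip s" "(\<lambda>n. \<integral>\<omega>. \<bar>Xn n \<omega> - X \<omega>\<bar> \<partial>P) \<longlonglongrightarrow> 0"
    using LG1_approximation(2)[OF X s] by blast
  have "(\<lambda>n. real k * (\<integral>\<omega>. \<bar>Xn n \<omega> - X \<omega>\<bar> \<partial>P)) \<longlonglongrightarrow> real k * 0"
    by (intro tendsto_intros Xn(2))
  then have "\<forall>\<^sub>F n in sequentially. real k * (\<integral>\<omega>. \<bar>Xn n \<omega> - X \<omega>\<bar> \<partial>P) < \<epsilon> / 2"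
    using \<epsilon> by (intro order_tendstoD(2)[where y = 0]) auto
  then obtain n where n: "real k * (\<integral>\<omega>. \<bar>Xn n \<omega> - X \<omega>\<bar> \<partial>P) < \<epsilon> / 2"
    by (auto simp: eventually_sequentially)
  have "(\<lambda>l. h k (l ! 0)) \<in> Cllip 1"
    unfolding h_def by (intro Cllip_max Cllip_diff Cllip_mult Cllip_const Cllip_nth) simp_all
  from Lip_comp1[OF s Xn(1) this] have Z: "(\<lambda>\<omega>. h k (Xn n \<omega>)) \<in> Lip s" .
  have intX: "integrable P X" by (rule LG1_approximation(1)[OF X s])
  have intXn: "integrable P (Xn n)" by (rule Lip_integrable[OF Xn(1) s])
  have int1: "integrable P (\<lambda>\<omega>. \<bar>indicator ?A \<omega> - h k (X \<omega>)\<bar>)"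
  proof (rule P.integrable_const_bound[where B = 1])
    show "AE \<omega> in P. norm \<bar>indicator ?A \<omega> - h k (X \<omega>)\<bar> \<le> 1"
    proof (rule AE_I2)
      fix \<omega> show "norm \<bar>indicator ?A \<omega> - h k (X \<omega>)\<bar> \<le> 1"
        using h(1,2)[of k "X \<omega>"] by (auto simp: indicator_def)
    qed
  qed measurable
  have int2: "integrable P (\<lambda>\<omega>. real k * \<bar>Xn n \<omega> - X \<omega>\<bar>)" using intX intXn by simp
  have "(\<integral>\<omega>. \<bar>indicator ?A \<omega> - h k (Xn n \<omega>)\<bar> \<partial>P) \<le>
      (\<integral>\<omega>. \<bar>indicator ?A \<omega> - h k (X \<omega>)\<bar> + real k * \<bar>Xn n \<omega> - X \<omega>\<bar> \<partial>P)"
  proof (rule integral_mono')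
    show "integrable P (\<lambda>\<omega>. \<bar>indicator ?A \<omega> - h k (X \<omega>)\<bar> + real k * \<bar>Xn n \<omega> - X \<omega>\<bar>)"
      using int1 int2 by (rule Bochner_Integration.integrable_add)
    show "\<bar>indicator ?A \<omega> - h k (Xn n \<omega>)\<bar> \<le> \<bar>indicator ?A \<omega> - h k (X \<omega>)\<bar> + real k * \<bar>Xn n \<omega> - X \<omega>\<bar>" for \<omega>
      using h(3)[of k "Xn n \<omega>" "X \<omega>"] by linarith
    show "0 \<le> \<bar>indicator ?A \<omega> - h k (X \<omega>)\<bar> + real k * \<bar>Xn n \<omega> - X \<omega>\<bar>" for \<omega> by simp
  qed
  also have "\<dots> = (\<integral>\<omega>. \<bar>indicator ?A \<omega> - h k (X \<omega>)\<bar> \<partial>P) + real k * (\<integral>\<omega>. \<bar>Xn n \<omega> - X \<omega>\<bar> \<partial>P)"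
    by (simp add: Bochner_Integration.integral_add[OF int1 int2])
  also have "\<dots> < \<epsilon>" using k n by simp
  finally show "\<exists>Z\<in>Lip s. (\<forall>\<omega>. 0 \<le> Z \<omega> \<and> Z \<omega> \<le> 1) \<and> (\<integral>\<omega>. \<bar>indicator ?A \<omega> - Z \<omega>\<bar> \<partial>P) < \<epsilon>"
    using h(1,2) by (intro bexI[OF _ Z]) auto
qed

lemma approximable_sublevel:
  assumes "X \<in> LG1 \<P> s" "0 \<le> s"
  shows "approximable s {\<omega>. X \<omega> \<le> c}"
  using approximable_superlevel[OF LG1_uminus[OF assms] assms(2), of "- c"] by simp

text \<open>\<open>D\<close> is only integrable, so smallness of \<open>\<integral>\<bar>1\<^sub>A - Z\<bar>\<close> controls \<open>\<integral>D (1\<^sub>A - Z)\<close> only after truncating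
  \<open>\<bar>D\<bar>\<close> at a level \<open>K\<close>.\<close>

lemma approximable_tested:
  assumes D: "integrable P D"
    and le: "\<And>Z. Z \<in> Lip s \<Longrightarrow> (\<And>\<omega>. 0 \<le> Z \<omega>) \<Longrightarrow> (\<And>\<omega>. Z \<omega> \<le> 1) \<Longrightarrow> (\<integral>\<omega>. D \<omega> * Z \<omega> \<partial>P) \<le> 0"
    and A: "approximable s A" and s: "0 \<le> s"
  shows "(\<integral>\<omega>. D \<omega> * indicator A \<omega> \<partial>P) \<le> 0"
proof (rule field_le_epsilon)
  fix \<epsilon> :: real assume \<epsilon>: "0 < \<epsilon>"
  have Dm [measurable]: "D \<in> borel_measurable P" using D by simp
  have [measurable]: "A \<in> sets P" using A by (simp add: approximable_def sets_P)
  have "(\<lambda>K. \<integral>\<omega>. \<bar>D \<omega>\<bar> - min \<bar>D \<omega>\<bar> (real K) \<partial>P) \<longlonglongrightarrow> (\<integral>\<omega>. 0 \<partial>P)"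
  proof (rule integral_dominated_convergence[where w = "\<lambda>\<omega>. \<bar>D \<omega>\<bar>"])
    show "AE \<omega> in P. (\<lambda>K. \<bar>D \<omega>\<bar> - min \<bar>D \<omega>\<bar> (real K)) \<longlonglongrightarrow> 0"
    proof (rule AE_I2)
      fix \<omega>
      obtain N :: nat where N: "\<bar>D \<omega>\<bar> \<le> real N" using real_arch_simple by blast
      then show "(\<lambda>K. \<bar>D \<omega>\<bar> - min \<bar>D \<omega>\<bar> (real K)) \<longlonglongrightarrow> 0"
        by (intro tendsto_eventually) (auto simp: eventually_sequentially intro!: exI[of _ N])
    qed
  qed (use D in auto)
  then have "\<forall>\<^sub>F K in sequentially. (\<integral>\<omega>. \<bar>D \<omega>\<bar> - min \<bar>D \<omega>\<bar> (real K) \<partial>P) < \<epsilon> / 2"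
    using \<epsilon> by (intro order_tendstoD(2)[where y = 0]) auto
  then obtain K where K: "(\<integral>\<omega>. \<bar>D \<omega>\<bar> - min \<bar>D \<omega>\<bar> (real K) \<partial>P) < \<epsilon> / 2"
    by (auto simp: eventually_sequentially)
  have "0 < \<epsilon> / (2 * (real K + 1))" using \<epsilon> by simp
  then obtain Z where Z: "Z \<in> Lip s" "\<And>\<omega>. 0 \<le> Z \<omega>" "\<And>\<omega>. Z \<omega> \<le> 1"
    "(\<integral>\<omega>. \<bar>indicator A \<omega> - Z \<omega>\<bar> \<partial>P) < \<epsilon> / (2 * (real K + 1))"
    using A unfolding approximable_def by blast
  have intZ: "integrable P Z" by (rule Lip_integrable[OF Z(1) s])
  have [measurable]: "Z \<in> borel_measurable P" using intZ by simp
  have int1: "integrable P (\<lambda>\<omega>. D \<omega> * Z \<omega>)"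
    using Z(2,3) by (intro Bochner_Integration.integrable_bound[OF D])
      (auto simp: abs_mult intro!: mult_right_le_one_le)
  have int2: "integrable P (\<lambda>\<omega>. \<bar>D \<omega>\<bar> - min \<bar>D \<omega>\<bar> (real K))"
    by (intro Bochner_Integration.integrable_bound[OF D]) auto
  have int3: "integrable P (\<lambda>\<omega>. real K * \<bar>indicator A \<omega> - Z \<omega>\<bar>)"
    using intZ by (intro integrable_mult_right integrable_abs Bochner_Integration.integrable_diff
      integrable_real_indicator) (auto simp: P.emeasure_finite less_top[symmetric])
  have "(\<integral>\<omega>. D \<omega> * indicator A \<omega> \<partial>P) \<le>
      (\<integral>\<omega>. D \<omega> * Z \<omega> + ((\<bar>D \<omega>\<bar> - min \<bar>D \<omega>\<bar> (real K)) + real K * \<bar>indicator A \<omega> - Z \<omega>\<bar>) \<partial>P)"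
  proof (rule integral_mono)
    show "integrable P (\<lambda>\<omega>. D \<omega> * indicator A \<omega>)"
      using D by (rule integrable_real_mult_indicator[rotated]) measurable
    show "integrable P (\<lambda>\<omega>. D \<omega> * Z \<omega> + ((\<bar>D \<omega>\<bar> - min \<bar>D \<omega>\<bar> (real K)) + real K * \<bar>indicator A \<omega> - Z \<omega>\<bar>))"
      by (intro Bochner_Integration.integrable_add int1 int2 int3)
    fix \<omega>
    let ?d = "\<bar>indicator A \<omega> - Z \<omega>\<bar>"
    have d: "0 \<le> ?d" "?d \<le> 1" using Z(2,3)[of \<omega>] by (auto simp: indicator_def)
    have "D \<omega> * indicator A \<omega> - D \<omega> * Z \<omega> \<le> \<bar>D \<omega>\<bar> * ?d"
      by (metis abs_ge_self abs_mult right_diff_distrib)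
    also have "\<dots> = (\<bar>D \<omega>\<bar> - min \<bar>D \<omega>\<bar> (real K)) * ?d + min \<bar>D \<omega>\<bar> (real K) * ?d"
      by (simp add: algebra_simps)
    also have "\<dots> \<le> (\<bar>D \<omega>\<bar> - min \<bar>D \<omega>\<bar> (real K)) + real K * ?d"
      using d by (intro add_mono mult_right_le_one_le mult_right_mono) auto
    finally show "D \<omega> * indicator A \<omega> \<le>
        D \<omega> * Z \<omega> + ((\<bar>D \<omega>\<bar> - min \<bar>D \<omega>\<bar> (real K)) + real K * ?d)" by linarith
  qed
  also have "\<dots> = (\<integral>\<omega>. D \<omega> * Z \<omega> \<partial>P) + ((\<integral>\<omega>. \<bar>D \<omega>\<bar> - min \<bar>D \<omega>\<bar> (real K) \<partial>P)
      + (\<integral>\<omega>. real K * \<bar>indicator A \<omega> - Z \<omega>\<bar> \<partial>P))"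
    by (simp only: Bochner_Integration.integral_add int1 int2 int3 Bochner_Integration.integrable_add)
  also have "(\<integral>\<omega>. real K * \<bar>indicator A \<omega> - Z \<omega>\<bar> \<partial>P) \<le> \<epsilon> / 2"
  proof -
    have "(\<integral>\<omega>. real K * \<bar>indicator A \<omega> - Z \<omega>\<bar> \<partial>P) = real K * (\<integral>\<omega>. \<bar>indicator A \<omega> - Z \<omega>\<bar> \<partial>P)" by simp
    also have "\<dots> \<le> real K * (\<epsilon> / (2 * (real K + 1)))"
      using Z(4) by (intro mult_left_mono) auto
    also have "\<dots> \<le> \<epsilon> / 2" using \<epsilon> by (simp add: field_simps)
    finally show ?thesis .
  qed
  finally show "(\<integral>\<omega>. D \<omega> * indicator A \<omega> \<partial>P) \<le> 0 + \<epsilon>"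
    using le[OF Z(1-3)] K by linarith
qed

text \<open>This is the supermartingale property of \<open>X\<close> under \<open>P\<close>. The conditional G-expectation serves as
  an intermediate variable: it lies below \<open>X u\<close> and dominates \<open>X v\<close> on average.\<close>

theorem supermartingale_tested:
  assumes X: "G_supermartingale E \<xi> \<P> T X" and uv: "0 \<le> u" "u \<le> v" "v \<le> T"
    and A: "approximable u A"
  shows "(\<integral>\<omega>. (X v \<omega> - X u \<omega>) * indicator A \<omega> \<partial>P) \<le> 0"
proof -
  obtain Y where Y: "has_cond_gexp E \<xi> \<P> u (X v) Y" "quasi_surely \<P> (\<lambda>\<omega>. Y \<omega> \<le> X u \<omega>)"
    using X uv unfolding G_supermartingale_def by (meson atLeastAtMost_iff order_trans)
  have intX: "integrable P (X u)" "integrable P (X v)"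
    using X uv by (auto intro!: LG1_approximation(1) simp: G_supermartingale_def)
  have "(\<lambda>\<omega>. 0) \<in> Lip u" using Lip_comp[of u "[]" "\<lambda>_. 0"] uv by simp
  from cond_gexp_dominates(2)[OF Y(1) this] have intY: "integrable P Y" by simp
  have [measurable]: "A \<in> sets P" using A by (simp add: approximable_def sets_P)
  have "(\<integral>\<omega>. (X v \<omega> - X u \<omega>) * indicator A \<omega> \<partial>P) \<le> (\<integral>\<omega>. (X v \<omega> - Y \<omega>) * indicator A \<omega> \<partial>P)"
  proof (rule integral_mono_AE)
    show "integrable P (\<lambda>\<omega>. (X v \<omega> - X u \<omega>) * indicator A \<omega>)"
      "integrable P (\<lambda>\<omega>. (X v \<omega> - Y \<omega>) * indicator A \<omega>)"
      using intX intY by (intro integrable_real_mult_indicator Bochner_Integration.integrable_diff; simp)+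
    show "AE \<omega> in P. (X v \<omega> - X u \<omega>) * indicator A \<omega> \<le> (X v \<omega> - Y \<omega>) * indicator A \<omega>"
      using quasi_surely_AE[OF Y(2)] by eventually_elim (auto intro: mult_right_mono)
  qed
  also have "\<dots> \<le> 0"
    using cond_gexp_dominates(3)[OF Y(1)] intX intY A uv(1) by (intro approximable_tested) auto
  finally show ?thesis .
qed

end

section \<open>Counting downcrossings along a path\<close>

text \<open>\<open>waiting a b x i\<close>: after \<open>x 0, \<dots>, x i\<close> the next event to wait for is the path reaching
  \<open>b\<close> from below; otherwise it is the path dropping to \<open>a\<close>.\<close>

primrec waiting :: "real \<Rightarrow> real \<Rightarrow> (nat \<Rightarrow> real) \<Rightarrow> nat \<Rightarrow> bool" where
  "waiting a b x 0 \<longleftrightarrow> x 0 < b"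
| "waiting a b x (Suc i) \<longleftrightarrow> x (Suc i) < b \<and> (x (Suc i) \<le> a \<or> waiting a b x i)"

primrec completed :: "real \<Rightarrow> real \<Rightarrow> (nat \<Rightarrow> real) \<Rightarrow> nat \<Rightarrow> nat" where
  "completed a b x 0 = 0"
| "completed a b x (Suc i) =
    completed a b x i + (if \<not> waiting a b x i \<and> x (Suc i) \<le> a then 1 else 0)"

lemma completed_mono: "i \<le> k \<Longrightarrow> completed a b x i \<le> completed a b x k"
  by (induction k) (auto simp: le_Suc_eq)

text \<open>At time \<open>s\<close> the path is waited for at \<open>a\<close>, at time \<open>r\<close> it is waited for at \<open>b\<close>, and the
  state can only have changed this way by completing a downcrossing.\<close>

lemma completed_gt:
  assumes "s < r" "b \<le> x s" "x r \<le> a" "a < b"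
  shows "completed a b x s < completed a b x r"
proof -
  have *: "waiting a b x (s + k) \<longrightarrow> completed a b x s < completed a b x (s + k)" for k
  proof (induction k)
    case 0
    show ?case using assms(2) by (cases s) auto
  next
    case (Suc k)
    then show ?case using completed_mono[of s "s + k" a b x] by (auto simp: less_Suc_eq_le)
  qed
  have "waiting a b x r" using assms by (cases r) auto
  then show ?thesis using *[of "r - s"] assms(1) by simp
qed

text \<open>The greedy count is maximal: by induction at least \<open>i\<close> downcrossings are completed by the end of
  the \<open>i\<close>-th one of any admissible choice.\<close>

lemma downcrossings_le_completed:
  assumes "a < b"
  shows "downcrossings a b x n \<le> completed a b x n"
proof -
  let ?S = "{k. \<exists>s r :: nat \<Rightarrow> nat.
      (\<forall>i\<in>{1..k}. s i < r i \<and> r i \<le> n \<and> x (s i) \<ge> b \<and> x (r i) \<le> a) \<and>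
      (\<forall>i\<in>{1..<k}. r i < s (Suc i))}"
  have le: "k \<le> completed a b x n" if k: "k \<in> ?S" for k
  proof -
    obtain s r :: "nat \<Rightarrow> nat" where sr:
      "\<And>i. 1 \<le> i \<Longrightarrow> i \<le> k \<Longrightarrow> s i < r i \<and> r i \<le> n \<and> x (s i) \<ge> b \<and> x (r i) \<le> a"
      "\<And>i. 1 \<le> i \<Longrightarrow> i < k \<Longrightarrow> r i < s (Suc i)"
      using k unfolding mem_Collect_eq by (metis atLeastAtMost_iff atLeastLessThan_iff)
    have "1 \<le> i \<Longrightarrow> i \<le> k \<Longrightarrow> i \<le> completed a b x (r i)" for i
    proof (induction i)
      case (Suc i)
      have gt: "completed a b x (s (Suc i)) < completed a b x (r (Suc i))"
        using sr(1)[of "Suc i"] Suc.prems assms by (intro completed_gt) auto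
      show ?case
      proof (cases "i = 0")
        case False
        then have "i \<le> completed a b x (r i)" using Suc by simp
        also have "\<dots> \<le> completed a b x (s (Suc i))"
          using sr(2)[of i] False Suc.prems by (intro completed_mono) auto
        finally show ?thesis using gt by simp
      qed (use gt in simp)
    qed simp
    from this[of k] show ?thesis
      using sr(1)[of k] completed_mono[of "r k" n a b x] by (cases "k = 0") auto
  qed
  have "?S \<subseteq> {..completed a b x n}" using le by auto
  then have "finite ?S" by (rule finite_subset) simp
  moreover have "0 \<in> ?S" by simp
  ultimately have "Max ?S \<in> ?S" by (intro Max_in) blast+
  then show ?thesis unfolding downcrossings_def by (rule le)
qed

text \<open>The right-hand side is the wealth of a trader with initial capital \<open>min (x 0) b\<close> who holds one
  unit of the asset exactly while waiting for \<open>b\<close>. If \<open>x 0 < b\<close> the capital buys that unit; otherwise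
  it is \<open>b\<close> in cash. Each completed downcrossing is a purchase at a price of at most \<open>a\<close> out of a
  reserve of \<open>b\<close>, and the next sale, at a price of at least \<open>b\<close>, restores the reserve.\<close>

lemma completed_wealth:
  assumes "a < b"
  shows "(b - a) * real (completed a b x n) + (if waiting a b x n then x n else b) \<le>
    min (x 0) b + (\<Sum>i<n. (x (Suc i) - x i) * of_bool (waiting a b x i))"
proof (induction n)
  case (Suc n)
  then show ?case using assms by (auto simp: algebra_simps split: if_splits)
qed (auto simp: min_def)

section \<open>Doob's inequality under a representing measure\<close>

context G_expectation_measure
begin

text \<open>The trading strategy is nonanticipating: whether a unit is held after \<open>t i\<close> is decided by the
  values observed up to \<open>t i\<close>.\<close>

lemma approximable_waiting:
  assumes X: "G_supermartingale E \<xi> \<P> T X" and t: "time_grid n t" "t n = T" and "i \<le> n"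
  shows "approximable (t i) {\<omega>. waiting a b (\<lambda>i. X (t i) \<omega>) i}"
  using \<open>i \<le> n\<close>
proof (induction i)
  case 0
  have "0 \<le> t 0" "t 0 \<le> T" using time_grid_nonneg[OF t(1)] time_grid_mono[OF t(1), of 0 n] t(2) by auto
  then have "approximable (t 0) (- {\<omega>. b \<le> X (t 0) \<omega>})"
    using X by (intro approximable_Compl approximable_superlevel) (auto simp: G_supermartingale_def)
  moreover have "- {\<omega>. b \<le> X (t 0) \<omega>} = {\<omega>. waiting a b (\<lambda>i. X (t i) \<omega>) 0}" by auto
  ultimately show ?case by simp
next
  case (Suc i)
  let ?s = "t (Suc i)"
  have s: "0 \<le> ?s" "?s \<le> T" and le: "t i \<le> ?s"
    using Suc.prems time_grid_nonneg[OF t(1)] time_grid_mono[OF t(1), of _ n]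
      time_grid_mono[OF t(1), of i "Suc i"] t(2) by auto
  then have XL: "X ?s \<in> LG1 \<P> ?s" using X by (auto simp: G_supermartingale_def)
  have IH: "approximable ?s {\<omega>. waiting a b (\<lambda>i. X (t i) \<omega>) i}"
    using Suc le by (auto intro: approximable_mono)
  have "approximable ?s (- {\<omega>. b \<le> X ?s \<omega>} \<inter>
      ({\<omega>. X ?s \<omega> \<le> a} \<union> {\<omega>. waiting a b (\<lambda>i. X (t i) \<omega>) i}))"
    using XL IH s(1)
    by (intro approximable_Compl approximable_superlevel approximable_Int approximable_Un
        approximable_sublevel)
  moreover have "- {\<omega>. b \<le> X ?s \<omega>} \<inter>
      ({\<omega>. X ?s \<omega> \<le> a} \<union> {\<omega>. waiting a b (\<lambda>i. X (t i) \<omega>) i}) =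
      {\<omega>. waiting a b (\<lambda>i. X (t i) \<omega>) (Suc i)}" by auto
  ultimately show ?case by simp
qed

text \<open>The inequality under a single measure: integrate the wealth bound, in which the gains
  have nonpositive expectation, and use \<open>X T \<ge> 0\<close> for the value of a unit still held at the end.\<close>

theorem ext_expectation_downcrossings:
  assumes X: "G_supermartingale E \<xi> \<P> T X" and t: "time_grid n t" "t n = T"
    and nonneg: "quasi_surely \<P> (\<lambda>\<omega>. 0 \<le> X T \<omega>)" and ab: "0 < a" "a < b"
  shows "ext_expectation P (\<lambda>\<omega>. real (downcrossings a b (\<lambda>i. X (t i) \<omega>) n))
    \<le> ereal (1 / (b - a)) * ext_expectation P (\<lambda>\<omega>. min (X 0 \<omega>) b)"
proof -
  have t0: "t 0 = 0" using t(1) by (simp add: time_grid_def)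
  have ti: "0 \<le> t i" "t i \<le> T" if "i \<le> n" for i
    using time_grid_nonneg[OF t(1)] time_grid_mono[OF t(1), of i n] t(2) that by auto
  have X_int: "integrable P (X (t i))" if "i \<le> n" for i
    using X ti[OF that] by (auto intro!: LG1_approximation(1) simp: G_supermartingale_def)
  define D where "D = (\<lambda>\<omega>. real (downcrossings a b (\<lambda>i. X (t i) \<omega>) n))"
  define W where "W = (\<lambda>i. {\<omega>. waiting a b (\<lambda>i. X (t i) \<omega>) i})"
  define S where "S = (\<lambda>i \<omega>. (X (t (Suc i)) \<omega> - X (t i) \<omega>) * indicator (W i) \<omega>)"
  define V where "V = (\<lambda>\<omega>. min (X 0 \<omega>) b + (\<Sum>i<n. S i \<omega>))"
  have W: "approximable (t i) (W i)" if "i \<le> n" for i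
    unfolding W_def using X t that by (rule approximable_waiting)
  have S_int: "integrable P (S i)" if "i < n" for i
    unfolding S_def using that W[of i] X_int[of i] X_int[of "Suc i"]
    by (intro integrable_real_mult_indicator Bochner_Integration.integrable_diff)
      (auto simp: approximable_def sets_P)
  have S_le: "(\<integral>\<omega>. S i \<omega> \<partial>P) \<le> 0" if "i < n" for i
    unfolding S_def using that W[of i] ti[of i] ti[of "Suc i"] time_grid_mono[OF t(1), of i "Suc i"]
    by (intro supermartingale_tested[OF X]) auto
  have min_int: "integrable P (\<lambda>\<omega>. min (X 0 \<omega>) b)"
    using X_int[of 0] by (intro integrable_min) (auto simp: t0)
  have V_int: "integrable P V"
    unfolding V_def using min_int S_int by (intro Bochner_Integration.integrable_add Bochner_Integration.integrable_sum) auto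
  have "(\<integral>\<omega>. V \<omega> \<partial>P) = (\<integral>\<omega>. min (X 0 \<omega>) b \<partial>P) + (\<Sum>i<n. \<integral>\<omega>. S i \<omega> \<partial>P)"
    unfolding V_def using min_int S_int
    by (subst Bochner_Integration.integral_add) (auto intro!: Bochner_Integration.integral_sum)
  also have "\<dots> \<le> (\<integral>\<omega>. min (X 0 \<omega>) b \<partial>P)"
    using sum_nonpos[of "{..<n}" "\<lambda>i. \<integral>\<omega>. S i \<omega> \<partial>P"] S_le by simp
  finally have V_le: "(\<integral>\<omega>. V \<omega> \<partial>P) \<le> (\<integral>\<omega>. min (X 0 \<omega>) b \<partial>P)" .
  have V_ge: "AE \<omega> in P. (b - a) * D \<omega> \<le> V \<omega>"
    using quasi_surely_AE[OF nonneg]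
  proof eventually_elim
    case (elim \<omega>)
    let ?x = "\<lambda>i. X (t i) \<omega>"
    have "(b - a) * D \<omega> \<le> (b - a) * real (completed a b ?x n)"
      using downcrossings_le_completed[OF ab(2), of ?x n] ab by (simp add: D_def)
    also have "\<dots> \<le> (b - a) * real (completed a b ?x n) + (if waiting a b ?x n then ?x n else b)"
      using elim ab t(2) by auto
    also have "\<dots> \<le> min (?x 0) b + (\<Sum>i<n. (?x (Suc i) - ?x i) * of_bool (waiting a b ?x i))"
      by (rule completed_wealth[OF ab(2)])
    also have "\<dots> = V \<omega>" by (simp add: V_def S_def W_def t0 indicator_def of_bool_def)
    finally show ?case .
  qed
  have D_nonneg: "0 \<le> D \<omega>" for \<omega> by (simp add: D_def)
  have AE_le: "AE \<omega> in P. D \<omega> \<le> V \<omega> / (b - a)" "AE \<omega> in P. 0 \<le> V \<omega> / (b - a)"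
  proof -
    show *: "AE \<omega> in P. D \<omega> \<le> V \<omega> / (b - a)"
      using V_ge by eventually_elim (use ab in \<open>simp add: field_simps\<close>)
    show "AE \<omega> in P. 0 \<le> V \<omega> / (b - a)"
      using * by eventually_elim (use D_nonneg order_trans in blast)
  qed
  have "(\<integral>\<^sup>+\<omega>. ennreal (D \<omega>) \<partial>P) \<le> (\<integral>\<^sup>+\<omega>. ennreal (V \<omega> / (b - a)) \<partial>P)"
    using AE_le(1) by (intro nn_integral_mono_AE) (auto intro: ennreal_leI)
  also have "\<dots> = ennreal (\<integral>\<omega>. V \<omega> / (b - a) \<partial>P)"
    using V_int AE_le(2) by (intro nn_integral_eq_integral) auto
  finally have "enn2ereal (\<integral>\<^sup>+\<omega>. ennreal (D \<omega>) \<partial>P) \<le> enn2ereal (ennreal (\<integral>\<omega>. V \<omega> / (b - a) \<partial>P))"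
    by (simp add: less_eq_ennreal.rep_eq)
  also have "\<dots> = ereal (\<integral>\<omega>. V \<omega> / (b - a) \<partial>P)"
    using integral_nonneg_AE[OF AE_le(2)] by (rule enn2ereal_ennreal)
  also have "\<dots> \<le> ereal (1 / (b - a) * (\<integral>\<omega>. min (X 0 \<omega>) b \<partial>P))"
    using V_le ab by (simp add: divide_right_mono)
  also have "\<dots> = ereal (1 / (b - a)) * ext_expectation P (\<lambda>\<omega>. min (X 0 \<omega>) b)"
    by (simp add: ext_expectation_integrable[OF min_int])
  finally show ?thesis
    using ext_expectation_nonneg[of D P] D_nonneg by (simp add: D_def)
qed

end

theorem theorem3p5:
  fixes \<sigma>\<^sub>0 T a b :: real and n :: nat and t :: "nat \<Rightarrow> real"
    and H :: "('b \<Rightarrow> real) set" and E :: "('b \<Rightarrow> real) \<Rightarrow> real" and \<xi> :: "nat \<Rightarrow> 'b \<Rightarrow> real"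
    and \<P> :: "C0 measure set" and X :: "real \<Rightarrow> C0 \<Rightarrow> real"
  assumes "0 \<le> \<sigma>\<^sub>0" and "\<sigma>\<^sub>0 \<le> 1"
    and "sublinear_expectation H E"
    and "G_normal_sequence \<sigma>\<^sub>0 H E \<xi>"
    and "represents_gexp E \<xi> \<P>"
    and "G_supermartingale E \<xi> \<P> T X"
    and "\<And>s. s \<in> {0..T} \<Longrightarrow> quasi_surely \<P> (\<lambda>\<omega>. 0 \<le> X s \<omega>)"
    and "t 0 = 0" and "t n = T" and "\<And>i. i < n \<Longrightarrow> t i < t (Suc i)"
    and "0 < a" and "a < b"
  shows "upper_exp \<P> (\<lambda>\<omega>. real (downcrossings a b (\<lambda>i. X (t i) \<omega>) n))
    \<le> ereal (1 / (b - a)) * upper_exp \<P> (\<lambda>\<omega>. min (X 0 \<omega>) b)"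
proof -
  have t: "time_grid n t" using assms(8,10) by (auto simp: time_grid_def less_imp_le)
  have T: "T \<in> {0..T}" using time_grid_nonneg[OF t, of n] assms(9) by simp
  have "ext_expectation P (\<lambda>\<omega>. real (downcrossings a b (\<lambda>i. X (t i) \<omega>) n))
      \<le> ereal (1 / (b - a)) * upper_exp \<P> (\<lambda>\<omega>. min (X 0 \<omega>) b)" if P: "P \<in> \<P>" for P
  proof -
    interpret G_expectation_measure H E \<sigma>\<^sub>0 \<xi> \<P> P
      using assms(3-5) P
      by (intro G_expectation_measure.intro G_normal_sequence_space.intro
          G_normal_sequence_space_axioms.intro G_expectation_measure_axioms.intro)
    have "ext_expectation P (\<lambda>\<omega>. real (downcrossings a b (\<lambda>i. X (t i) \<omega>) n))
        \<le> ereal (1 / (b - a)) * ext_expectation P (\<lambda>\<omega>. min (X 0 \<omega>) b)"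
      by (rule ext_expectation_downcrossings[OF assms(6) t assms(9) assms(7)[OF T] assms(11,12)])
    also have "\<dots> \<le> ereal (1 / (b - a)) * upper_exp \<P> (\<lambda>\<omega>. min (X 0 \<omega>) b)"
      using assms(12) by (intro ereal_mult_left_mono ext_expectation_le_upper_exp P) simp
    finally show ?thesis .
  qed
  then show ?thesis unfolding upper_exp_def[of _ "\<lambda>\<omega>. real (downcrossings a b (\<lambda>i. X (t i) \<omega>) n)"]
    by (rule SUP_least)
qed

end
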